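(* Let $F$ be a field and let $f\colon\mathbb{N}\to\mathbb{N}$ be an increasing, submultiplicative function. Then there exists a finitely generated primitive $F$-algebra $A$ such that $f(n)\preceq\gamma_A(n)\preceq n^2f(n)$.
   Context: $\mathbb{N}=\{1,2,3,\dots\}$. A function $f\colon\mathbb{N}\to\mathbb{N}$ is increasing if $f(n)<f(n+1)$ for all $n$, and submultiplicative if $f(n+m)\le f(n)f(m)$ for all $n,m$. For functions $f,g$ on $\mathbb{N}$, $f\preceq g$ means that there is $C\in\mathbb{N}$ with $f(n)\le g(Cn)$ for all $n\in\mathbb{N}$; $f\sim g$ means $f\preceq g$ and $g\preceq f$. Algebras are associative. For a finitely generated $F$-algebra $A$ with finite-dimensional generating subspace $V$, $\gamma_{A,V}(n)=\dim_F(F+V+V^2+\cdots+V^n)$; $\gamma_A$ denotes this function for some choice of $V$ (it is independent of $V$ up to $\sim$). An algebra is primitive if it acts faithfully on an irreducible module. *)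

theory Defs
  imports "Jordan_Normal_Form.Missing_VectorSpace"
begin

text \<open>The locale \<open>algebra\<close> of HOL-Algebra assumes commutative multiplication, so associative unital
  algebras over a field are introduced here, on the same record type.\<close>

locale assoc_algebra = vectorspace F A + alg?: ring A for F and A (structure) +
  assumes smult_mult_left:
      "\<lbrakk>c \<in> carrier F; x \<in> carrier A; y \<in> carrier A\<rbrakk> \<Longrightarrow> (c \<odot> x) \<otimes> y = c \<odot> (x \<otimes> y)"
    and smult_mult_right:
      "\<lbrakk>c \<in> carrier F; x \<in> carrier A; y \<in> carrier A\<rbrakk> \<Longrightarrow> x \<otimes> (c \<odot> y) = c \<odot> (x \<otimes> y)"

definition unital_subalgebra ::
    "('f, 'e) ring_scheme \<Rightarrow> 'a set \<Rightarrow> ('f, 'a, 'm) module_scheme \<Rightarrow> bool" where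
  "unital_subalgebra F B A \<longleftrightarrow> VectorSpace.subspace F B A \<and> \<one>\<^bsub>A\<^esub> \<in> B \<and>
     (\<forall>x\<in>B. \<forall>y\<in>B. x \<otimes>\<^bsub>A\<^esub> y \<in> B)"

definition generates_algebra ::
    "('f, 'e) ring_scheme \<Rightarrow> ('f, 'a, 'm) module_scheme \<Rightarrow> 'a set \<Rightarrow> bool" where
  "generates_algebra F A S \<longleftrightarrow> S \<subseteq> carrier A \<and>
     (\<forall>B. unital_subalgebra F B A \<and> S \<subseteq> B \<longrightarrow> B = carrier A)"

definition finitely_generated_algebra ::
    "('f, 'e) ring_scheme \<Rightarrow> ('f, 'a, 'm) module_scheme \<Rightarrow> bool" where
  "finitely_generated_algebra F A \<longleftrightarrow>
     assoc_algebra F A \<and> (\<exists>S. finite S \<and> generates_algebra F A S)"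

definition generating_subspace ::
    "('f, 'e) ring_scheme \<Rightarrow> ('f, 'a, 'm) module_scheme \<Rightarrow> 'a set \<Rightarrow> bool" where
  "generating_subspace F A V \<longleftrightarrow> VectorSpace.subspace F V A \<and>
     vectorspace.fin_dim F (A\<lparr>carrier := V\<rparr>) \<and> generates_algebra F A V"

text \<open>Quantifying over all generating subspaces of a finitely generated algebra is never vacuous.\<close>

lemma generating_subspace_exists:
  assumes "finitely_generated_algebra F A"
  shows "\<exists>V. generating_subspace F A V"
proof -
  from assms obtain S where A: "assoc_algebra F A" and S: "finite S" "generates_algebra F A S"
    unfolding finitely_generated_algebra_def by auto
  interpret assoc_algebra F A by fact
  have SA: "S \<subseteq> carrier A" using S by (simp add: generates_algebra_def)
  have sm: "LinearCombinations.submodule F (span S) A" using span_is_submodule[OF SA] .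
  have sub: "VectorSpace.subspace F (span S) A" using span_is_subspace[OF SA] .
  have SS: "S \<subseteq> span S" using in_own_span[OF SA] .
  have "vectorspace.fin_dim F (A\<lparr>carrier := span S\<rparr>)"
    unfolding vectorspace.fin_dim_def[OF subspace_is_vs[OF sub]]
    using span_li_not_depend(1)[OF SS sm] S SS by auto
  moreover have "generates_algebra F A (span S)"
    using S SS sm unfolding generates_algebra_def LinearCombinations.submodule_def by (meson order_trans)
  ultimately show ?thesis using sub unfolding generating_subspace_def by blast
qed

text \<open>In \<open>F + V + V\<^sup>2 + \<dots>\<close> the summand \<open>F\<close> means \<open>F \<cdot> 1\<close>, which is the zeroth power below; a sum of
  subspaces is the span of their union.\<close>

primrec subspace_power ::
    "('f, 'e) ring_scheme \<Rightarrow> ('f, 'a, 'm) module_scheme \<Rightarrow> 'a set \<Rightarrow> nat \<Rightarrow> 'a set" where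
  "subspace_power F A V 0 = module.span F A {\<one>\<^bsub>A\<^esub>}"
| "subspace_power F A V (Suc k) =
     module.span F A {x \<otimes>\<^bsub>A\<^esub> v | x v. x \<in> subspace_power F A V k \<and> v \<in> V}"

definition growth ::
    "('f, 'e) ring_scheme \<Rightarrow> ('f, 'a, 'm) module_scheme \<Rightarrow> 'a set \<Rightarrow> nat \<Rightarrow> nat" where
  "growth F A V n =
     vectorspace.dim F (A\<lparr>carrier := module.span F A (\<Union>k\<le>n. subspace_power F A V k)\<rparr>)"

text \<open>The locale \<open>module\<close> of HOL-Algebra assumes a commutative ring of scalars; this is the same set
  of axioms over an arbitrary ring.\<close>

locale left_module = R?: ring R + M?: abelian_group M
  for R :: "('a, 'r) ring_scheme" and M :: "('a, 'b, 'm) module_scheme" (structure) +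
  assumes smult_closed: "\<lbrakk>a \<in> carrier R; x \<in> carrier M\<rbrakk> \<Longrightarrow> a \<odot> x \<in> carrier M"
    and smult_l_distr:
      "\<lbrakk>a \<in> carrier R; b \<in> carrier R; x \<in> carrier M\<rbrakk> \<Longrightarrow> (a \<oplus>\<^bsub>R\<^esub> b) \<odot> x = a \<odot> x \<oplus> b \<odot> x"
    and smult_r_distr:
      "\<lbrakk>a \<in> carrier R; x \<in> carrier M; y \<in> carrier M\<rbrakk> \<Longrightarrow> a \<odot> (x \<oplus> y) = a \<odot> x \<oplus> a \<odot> y"
    and smult_assoc1:
      "\<lbrakk>a \<in> carrier R; b \<in> carrier R; x \<in> carrier M\<rbrakk> \<Longrightarrow> (a \<otimes>\<^bsub>R\<^esub> b) \<odot> x = a \<odot> (b \<odot> x)"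
    and smult_one: "x \<in> carrier M \<Longrightarrow> \<one>\<^bsub>R\<^esub> \<odot> x = x"

definition irreducible_module ::
    "('a, 'r) ring_scheme \<Rightarrow> ('a, 'b, 'm) module_scheme \<Rightarrow> bool" where
  "irreducible_module R M \<longleftrightarrow> left_module R M \<and> carrier M \<noteq> {\<zero>\<^bsub>M\<^esub>} \<and>
     (\<forall>N. Module.submodule N R M \<longrightarrow> N = {\<zero>\<^bsub>M\<^esub>} \<or> N = carrier M)"

definition faithful_module ::
    "('a, 'r) ring_scheme \<Rightarrow> ('a, 'b, 'm) module_scheme \<Rightarrow> bool" where
  "faithful_module R M \<longleftrightarrow>
     (\<forall>a\<in>carrier R. (\<forall>x\<in>carrier M. a \<odot>\<^bsub>M\<^esub> x = \<zero>\<^bsub>M\<^esub>) \<longrightarrow> a = \<zero>\<^bsub>R\<^esub>)"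

text \<open>Every irreducible module over a ring \<open>R\<close> is isomorphic to \<open>R / L\<close> for a maximal left ideal
  \<open>L\<close>, whose elements are subsets of \<open>R\<close>. Hence fixing the type of the module below as sets of ring
  elements loses no irreducible module.\<close>

definition primitive_ring :: "('a, 'r) ring_scheme \<Rightarrow> bool" where
  "primitive_ring R \<longleftrightarrow>
     (\<exists>M :: ('a, 'a set) module. irreducible_module R M \<and> faithful_module R M)"

text \<open>The mathematical natural numbers start at 1 here; values at 0 play no role.\<close>

definition growth_preceq :: "(nat \<Rightarrow> nat) \<Rightarrow> (nat \<Rightarrow> nat) \<Rightarrow> bool" (infix \<open>\<preceq>\<^sub>g\<close> 50) where
  "f \<preceq>\<^sub>g g \<longleftrightarrow> (\<exists>C\<ge>1. \<forall>n\<ge>1. f n \<le> g (C * n))"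

definition increasing_fun :: "(nat \<Rightarrow> nat) \<Rightarrow> bool" where
  "increasing_fun f \<longleftrightarrow> (\<forall>n\<ge>1. f n < f (n + 1))"

definition submultiplicative_fun :: "(nat \<Rightarrow> nat) \<Rightarrow> bool" where
  "submultiplicative_fun f \<longleftrightarrow> (\<forall>n\<ge>1. \<forall>m\<ge>1. f (n + m) \<le> f n * f m)"

text \<open>A finitely generated algebra is spanned by words in its generators, so it is isomorphic to one
  whose elements are the finitely supported functions from a set of words (a basis) to \<open>F\<close>. Hence the
  existence of an algebra on the type \<^typ>\<open>nat list \<Rightarrow> 'f\<close> is the existence of an algebra on any type.\<close>

end

theory Submission
  imports Defs "HOL-Library.Sublist" "HOL-Library.Nat_Bijection" "Jordan_Normal_Form.Missing_Ring"
begin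

text \<open>
  The algebra is generated by linear operators on a vector space whose basis is the vertex set of
  a directed graph; every generator moves the vertices along edges and is a partial injection.
  The vertices are a tree of words over \<open>{1..f 1}\<close>, with the empty word as root, and a ray of the
  words \<open>0\<dots>0\<close>, which starts at the root as well. The generator \<open>Up a\<close> prepends the letter \<open>a\<close> to a word of
  the tree, \<open>Down\<close> goes one step along the ray towards the root, and \<open>Jump\<close> sends some words \<open>v\<close> of the
  tree, the blocks, to the vertex number \<open>N v\<close> of the ray.

  \<^bold>\<open>Primitivity.\<close> Every vertex can be moved to every other one: from the tree by completing a word to
  a block, jumping, and descending to the root. Since the moves are injective, a word that leads
  from \<open>s\<close> to \<open>t\<close> transports the coefficient of \<open>s\<close> to \<open>t\<close> without mixing it with others. As \<open>Down\<close>
  followed by \<open>Up 1\<close> is an operator of rank one, it cuts out a single coefficient, and so the space of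
  finitely supported vectors is irreducible (\<open>op_algebra_primitive\<close>). It is faithful because the
  elements of the algebra are operators.

  \<^bold>\<open>Growth.\<close> Blocks of length \<open>2 ^ k\<close> are built as products \<open>U (k + 1) = C k U k\<close> with
  \<open>C k \<subseteq> U k\<close>. Submultiplicativity yields \<open>f (2 ^ (k + 1)) \<le> (f (2 ^ k))\<^sup>2\<close>, which leaves room
  for a choice of \<open>C k\<close> with \<open>f (2 ^ k) \<le> card (U k) \<le> 2 * f (2 ^ k)\<close> (\<open>block_sequence_exists\<close>). The lower
  bound for the growth is the number of blocks, because the blocks label linearly independent operators.
  For the upper bound it suffices to count the partial injections that are products of at most \<open>n\<close>
  generators (\<open>transformations_card\<close>). A product that descends to the root and goes on into the tree has
  rank at most one, so it is given by its source and its target. Sources are the vertices with a short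
  way to the root, and there are only linearly many of them if the jumps of different words and
  their suffixes are kept apart on the ray; targets are the vertices near to the root in the other
  direction, of which there are about \<open>n * f n\<close>. This gives \<open>n\<^sup>2 * f n\<close> up to constants. The other
  nonzero products are the powers of \<open>Down\<close>, the prependings of a factor \<open>u\<close> of a block, about
  \<open>n\<^sup>2 * f n\<close> in number, and the maps
  \<open>Down\<^sup>k Jump Up u\<close>, where \<open>u\<close> is even a prefix of a block: about \<open>n * f n\<close> words \<open>u\<close> and \<open>n\<close>
  values of \<open>k\<close>. It is to keep this last number small that \<open>Jump\<close> is restricted to blocks.
\<close>

section \<open>A language of blocks with prescribed cardinalities\<close>

lemma increasing_mono:
  assumes "increasing_fun f" "1 \<le> m" "m \<le> n"
  shows "f m \<le> f n"
  using assms(3)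
proof (induction n rule: dec_induct)
  case base then show ?case by simp
next
  case (step k)
  then have "f k < f (k + 1)" using assms(1,2) by (simp add: increasing_fun_def)
  with step show ?case by simp
qed

lemma exists_power_two_above:
  assumes "1 \<le> (n::nat)"
  shows "\<exists>k. n \<le> 2 ^ k \<and> 2 ^ k < 2 * n"
proof -
  define k where "k = (LEAST k. n \<le> 2 ^ k)"
  have ex: "\<exists>k. n \<le> 2 ^ k" using less_exp[of n] less_imp_le by blast
  have 1: "n \<le> 2 ^ k" unfolding k_def using ex by (rule LeastI_ex)
  have "2 ^ k < 2 * n"
  proof (cases k)
    case 0 then show ?thesis using assms by simp
  next
    case (Suc j)
    have "\<not> n \<le> 2 ^ j" using not_less_Least[of j "\<lambda>k. n \<le> 2 ^ k"] Suc unfolding k_def by simp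
    then show ?thesis using Suc by simp
  qed
  with 1 show ?thesis by blast
qed

definition concats :: "'a list set \<Rightarrow> 'a list set \<Rightarrow> 'a list set" where
  "concats C U = (\<lambda>(c, u). c @ u) ` (C \<times> U)"

lemma card_concats:
  assumes "\<And>u. u \<in> U \<Longrightarrow> length u = l" "\<And>c. c \<in> C \<Longrightarrow> length c = l"
  shows "card (concats C U) = card C * card U"
proof -
  have "inj_on (\<lambda>(c, u). c @ u) (C \<times> U)"
    using assms by (auto simp: inj_on_def)
  then show ?thesis unfolding concats_def by (simp add: card_image card_cartesian_product)
qed

lemma card_bounded_length:
  fixes S :: "'a list set"
  assumes "\<And>m. 1 \<le> m \<Longrightarrow> m \<le> n \<Longrightarrow> finite {u\<in>S. length u = m} \<and> card {u\<in>S. length u = m} \<le> b"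
  shows "finite {u\<in>S. length u \<le> n} \<and> card {u\<in>S. length u \<le> n} \<le> 1 + n * b"
proof -
  let ?R = "{[]} \<union> (\<Union>m\<in>{1..n}. {u\<in>S. length u = m})"
  have sub: "{u\<in>S. length u \<le> n} \<subseteq> ?R"
  proof
    fix u assume "u \<in> {u\<in>S. length u \<le> n}"
    then show "u \<in> ?R" by (cases u) auto
  qed
  have fin: "finite ?R" using assms by auto
  have "card (\<Union>m\<in>{1..n}. {u\<in>S. length u = m}) \<le> (\<Sum>m\<in>{1..n}. card {u\<in>S. length u = m})"
    by (rule card_UN_le) simp
  also have "\<dots> \<le> (\<Sum>m\<in>{1..n}. b)" using assms by (intro sum_mono) auto
  finally have "card (\<Union>m\<in>{1..n}. {u\<in>S. length u = m}) \<le> n * b" by simp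
  then have "card ?R \<le> 1 + n * b" using card_Un_le[of "{[]}" "\<Union>m\<in>{1..n}. {u\<in>S. length u = m}"] by simp
  then show ?thesis using finite_subset[OF sub fin] card_mono[OF fin sub] by (meson le_trans)
qed

locale block_language =
  fixes f :: "nat \<Rightarrow> nat" and U C :: "nat \<Rightarrow> nat list set"
  assumes f_pos: "\<forall>n\<ge>1. f n \<ge> 1" and f_inc: "increasing_fun f"
    and U_0: "U 0 = (\<lambda>a. [a]) ` {1..f 1}"
    and finite_U: "finite (U k)"
    and length_U: "u \<in> U k \<Longrightarrow> length u = 2 ^ k"
    and zero_notin_U: "u \<in> U k \<Longrightarrow> 0 \<notin> set u"
    and card_U_ge: "f (2 ^ k) \<le> card (U k)"
    and card_U_le: "card (U k) \<le> 2 * f (2 ^ k)"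
    and C_subset: "C k \<subseteq> U k"
    and C_nonempty: "C k \<noteq> {}"
    and U_Suc: "U (Suc k) = concats (C k) (U k)"

text \<open>The set \<open>C k\<close> is an arbitrary subset of \<open>U k\<close> of the least size for which \<open>C k U k\<close> has at least
\<open>f (2 ^ Suc k)\<close> elements. The upper bound on the size survives the rounding: either one element of
\<open>C k\<close> is enough and the cardinality stays the same, or the excess is smaller than \<open>card (U k)\<close>, which is then
itself smaller than \<open>f (2 ^ Suc k)\<close>.\<close>
lemma block_sequence_exists:
  fixes f :: "nat \<Rightarrow> nat"
  assumes pos: "\<forall>n\<ge>1. f n \<ge> 1" and inc: "increasing_fun f" and sub: "submultiplicative_fun f"
  shows "\<exists>U C. block_language f U C"
proof -
  define P where "P k V \<longleftrightarrow> (k = 0 \<longrightarrow> V = (\<lambda>a. [a]) ` {1..f 1}) \<and> finite V \<and>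
     (\<forall>u\<in>V. length u = 2 ^ k \<and> 0 \<notin> set u) \<and> f (2 ^ k) \<le> card V \<and> card V \<le> 2 * f (2 ^ k)"
    for k and V :: "nat list set"
  define Q where "Q V V' \<longleftrightarrow> (\<exists>C. C \<subseteq> V \<and> C \<noteq> {} \<and> V' = concats C V)" for V V' :: "nat list set"
  have "\<exists>U. \<forall>k. P k (U k) \<and> Q (U k) (U (Suc k))"
  proof (rule dependent_nat_choice)
    have "card ((\<lambda>a. [a]) ` {1..f 1}) = f 1" by (subst card_image) (auto simp: inj_on_def)
    then show "\<exists>V. P 0 V" unfolding P_def by (intro exI[of _ "(\<lambda>a. [a]) ` {1..f 1}"]) auto
  next
    fix V k assume PV: "P k V"
    let ?F = "f (2 ^ Suc k)"
    \<comment> \<open>the quotient of \<open>?F\<close> by \<open>card V\<close>, rounded up\<close>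
    define q where "q = (?F + card V - 1) div card V"
    have cV: "card V \<ge> 1" using PV pos unfolding P_def by (metis one_le_numeral one_le_power order_trans)
    have "?F \<le> f (2 ^ k) * f (2 ^ k)"
    proof -
      have "f (2 ^ k + 2 ^ k) \<le> f (2 ^ k) * f (2 ^ k)"
        using sub unfolding submultiplicative_fun_def by simp
      then show ?thesis by (simp add: mult_2)
    qed
    also have "\<dots> \<le> card V * card V" using PV unfolding P_def by (intro mult_le_mono) auto
    finally have Fle: "?F \<le> card V * card V" .
    have F1: "?F \<ge> 1" using pos by simp
    have qle: "q \<le> card V"
    proof -
      have "?F + card V - 1 < card V * (card V + 1)" using Fle cV by simp
      then have "q < card V + 1" unfolding q_def
        using cV by (subst less_mult_imp_div_less) (auto simp: mult.commute)
      then show ?thesis by simp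
    qed
    have q1: "q \<ge> 1" unfolding q_def using F1 cV
      by (metis Nat.add_diff_assoc2 One_nat_def Suc_le_eq add.commute div_greater_zero_iff le_add1)
    obtain C where C: "C \<subseteq> V" "card C = q" "finite C"
      using obtain_subset_with_card_n[OF qle] by blast
    have C0: "C \<noteq> {}" using C q1 by auto
    have card: "card (concats C V) = q * card V"
      using card_concats[of V "2 ^ k" C] PV C unfolding P_def by blast
    have lower: "?F \<le> q * card V"
    proof -
      have "?F + card V - 1 = q * card V + (?F + card V - 1) mod card V" unfolding q_def by simp
      moreover have "(?F + card V - 1) mod card V < card V" using cV by simp
      ultimately show ?thesis using cV by linarith
    qed
    have upper: "q * card V \<le> 2 * ?F"
    proof (cases "?F \<le> card V")
      case True
      have "q < 2" unfolding q_def using True cV F1 by (intro less_mult_imp_div_less) auto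
      then have "q = 1" using q1 by simp
      moreover have "f (2 ^ k) \<le> ?F" by (rule increasing_mono[OF inc]) auto
      ultimately show ?thesis using PV unfolding P_def by simp
    next
      case False
      have "q * card V \<le> ?F + card V - 1" unfolding q_def by simp
      then show ?thesis using False by simp
    qed
    have "P (Suc k) (concats C V)"
      unfolding P_def card using lower upper PV C
      by (auto simp: P_def concats_def)
    then show "\<exists>V'. P (Suc k) V' \<and> Q V V'" unfolding Q_def using C C0 by blast
  qed
  then obtain U where U: "\<And>k. P k (U k)" "\<And>k. Q (U k) (U (Suc k))" by blast
  from U(2) obtain C where C: "\<And>k. C k \<subseteq> U k \<and> C k \<noteq> {} \<and> U (Suc k) = concats (C k) (U k)"
    unfolding Q_def by metis
  have "block_language f U C"
  proof
    show "\<forall>n\<ge>1. f n \<ge> 1" "increasing_fun f" by (fact pos, fact inc)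
    show "U 0 = (\<lambda>a. [a]) ` {1..f 1}" using U(1)[of 0] unfolding P_def by simp
    fix k
    show "finite (U k)" "f (2 ^ k) \<le> card (U k)" "card (U k) \<le> 2 * f (2 ^ k)"
      using U(1)[of k] unfolding P_def by simp_all
    show "length u = 2 ^ k" "0 \<notin> set u" if "u \<in> U k" for u
      using U(1)[of k] that unfolding P_def by simp_all
    show "C k \<subseteq> U k" "C k \<noteq> {}" "U (Suc k) = concats (C k) (U k)" using C[of k] by simp_all
  qed
  then show ?thesis by blast
qed

context block_language
begin

lemma f_mono: "1 \<le> m \<Longrightarrow> m \<le> n \<Longrightarrow> f m \<le> f n"
  using increasing_mono[OF f_inc] .

definition blocks :: "nat list set" where "blocks = (\<Union>k. U k)"
definition tails :: "nat list set" where "tails = {w. \<exists>v\<in>blocks. suffix w v}"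

lemma U_nonempty: "U k \<noteq> {}" using C_subset C_nonempty by blast

lemma block_suffix_of_later: "k \<le> j \<Longrightarrow> v \<in> U k \<Longrightarrow> \<exists>v'\<in>U j. suffix v v'"
proof (induction j rule: dec_induct)
  case base then show ?case by auto
next
  case (step j)
  then obtain v' where "v' \<in> U j" "suffix v v'" by blast
  moreover obtain c where "c \<in> C j" using C_nonempty by blast
  ultimately show ?case unfolding U_Suc concats_def
    by (intro bexI[of _ "c @ v'"]) (auto intro: suffix_appendI)
qed

lemma drop_in_U: "k \<le> j \<Longrightarrow> v \<in> U j \<Longrightarrow> drop (2 ^ j - 2 ^ k) v \<in> U k"
proof (induction j arbitrary: v rule: dec_induct)
  case base then show ?case by simp
next
  case (step j)
  then obtain c u where v: "v = c @ u" "c \<in> C j" "u \<in> U j" unfolding U_Suc concats_def by auto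
  have "length c = 2 ^ j" using v C_subset length_U by blast
  moreover have "(2::nat) ^ k \<le> 2 ^ j" using step by simp
  then have "2 ^ Suc j - 2 ^ k = (2::nat) ^ j + (2 ^ j - 2 ^ k)" by simp
  ultimately have "drop (2 ^ Suc j - 2 ^ k) v = drop (2 ^ j - 2 ^ k) u" using v by simp
  then show ?case using step v by simp
qed

lemma take_in_C: "k < j \<Longrightarrow> v \<in> U j \<Longrightarrow> take (2 ^ k) v \<in> C k"
proof (induction j arbitrary: v)
  case 0 then show ?case by simp
next
  case (Suc j)
  then obtain c u where v: "v = c @ u" "c \<in> C j" "u \<in> U j" unfolding U_Suc concats_def by auto
  have l: "length c = 2 ^ j" using v C_subset length_U by blast
  show ?case
  proof (cases "k = j")
    case True then show ?thesis using v l by simp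
  next
    case False
    then have "k < j" using Suc by simp
    moreover have "(2::nat) ^ k \<le> 2 ^ j" using \<open>k < j\<close> by simp
    ultimately show ?thesis using Suc.IH[of c] v l C_subset[of j] by (auto simp: subset_iff)
  qed
qed

lemma take_in_U: "k \<le> j \<Longrightarrow> v \<in> U j \<Longrightarrow> take (2 ^ k) v \<in> U k"
  using take_in_C[of k j v] C_subset[of k] length_U[of v j] by (cases "k = j") auto

text \<open>In a block of higher level every second constituent of length \<open>2 ^ k\<close> comes from \<open>C k\<close>. Hence two
neighbours can be chosen in about \<open>card (U (Suc k))\<close> ways, and not in \<open>(card (U k))\<^sup>2\<close> ways.\<close>
definition adjacent_pairs :: "nat \<Rightarrow> (nat list \<times> nat list) set" where
  "adjacent_pairs k = C k \<times> U k \<union> U k \<times> C k"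

text \<open>Induction on the level of the block: a factor that straddles the border of \<open>c @ w\<close> with \<open>c\<close>, \<open>w\<close> in \<open>U j\<close> only
meets the last \<open>2 ^ k\<close> letters of \<open>c\<close>, which are in \<open>U k\<close>, and the first \<open>2 ^ k\<close> letters of \<open>w\<close>, which are in
\<open>C k\<close>. Blocks of low level are suffixes of blocks of high level.\<close>
lemma factor_in_adjacent_pair:
  assumes "sublist u v" "v \<in> blocks" "length u \<le> 2 ^ k"
  shows "\<exists>(p, q)\<in>adjacent_pairs k. sublist u (p @ q)"
proof -
  have later: "\<exists>(p, q)\<in>adjacent_pairs k. sublist u (p @ q)" if "k < j" "v \<in> U j" "sublist u v" for j v
    using that
  proof (induction j arbitrary: v)
    case 0 then show ?case by simp
  next
    case (Suc j)
    obtain c w where v: "v = c @ w" "c \<in> C j" "w \<in> U j" using Suc.prems unfolding U_Suc concats_def by auto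
    show ?case
    proof (cases "k = j")
      case True
      then show ?thesis using v Suc.prems unfolding adjacent_pairs_def by blast
    next
      case False
      then have kj: "k < j" using Suc.prems by simp
      have cU: "c \<in> U j" using v C_subset by blast
      consider "sublist u c" | "sublist u w"
        | u1 u2 where "u = u1 @ u2" "suffix u1 c" "prefix u2 w"
        using Suc.prems(3) unfolding v(1) sublist_append by blast
      then show ?thesis
      proof cases
        case 1 then show ?thesis using Suc.IH kj cU by blast
      next
        case 2 then show ?thesis using Suc.IH kj v by blast
      next
        case 3
        let ?p = "drop (2 ^ j - 2 ^ k) c" and ?q = "take (2 ^ k) w"
        have "?p \<in> U k" using drop_in_U kj cU by simp
        moreover have "?q \<in> C k" using take_in_C kj v by simp
        moreover have "suffix u1 ?p"
        proof -
          have "suffix ?p c" by (rule suffix_drop)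
          moreover have "length u1 \<le> length ?p"
            using assms(3) 3 \<open>?p \<in> U k\<close> length_U by fastforce
          ultimately show ?thesis using 3 suffix_length_suffix by blast
        qed
        moreover have "prefix u2 ?q"
        proof -
          have "prefix ?q w" by (rule take_is_prefix)
          moreover have "length u2 \<le> length ?q"
            using assms(3) 3 \<open>?q \<in> C k\<close> C_subset[of k] length_U by fastforce
          ultimately show ?thesis using 3 prefix_length_prefix by blast
        qed
        ultimately show ?thesis unfolding adjacent_pairs_def 3(1)
          by (intro bexI[of _ "(?p, ?q)"]) (auto simp: sublist_append)
      qed
    qed
  qed
  obtain i where i: "v \<in> U i" using assms(2) unfolding blocks_def by blast
  obtain v' where "v' \<in> U (max i (Suc k))" "suffix v v'"
    using block_suffix_of_later[OF _ i, of "max i (Suc k)"] by auto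
  then show ?thesis using later[of "max i (Suc k)" v'] assms(1)
    by (meson less_max_iff_disj lessI sublist_order.order_trans suffix_imp_sublist)
qed

definition factors :: "nat list set" where "factors = {u. \<exists>v\<in>blocks. sublist u v}"
definition heads :: "nat list set" where "heads = {u. \<exists>v\<in>blocks. prefix u v}"

lemma heads_of_length:
  assumes "1 \<le> m"
  shows "finite {u\<in>heads. length u = m} \<and> card {u\<in>heads. length u = m} \<le> 2 * f (2 * m)"
proof -
  obtain k where k: "m \<le> 2 ^ k" "2 ^ k < 2 * m" using exists_power_two_above[OF assms] by blast
  have "{u\<in>heads. length u = m} \<subseteq> take m ` U k"
  proof
    fix u assume "u \<in> {u\<in>heads. length u = m}"
    then obtain v j where u: "length u = m" "prefix u v" "v \<in> U j" unfolding heads_def blocks_def by blast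
    have "m \<le> 2 ^ j" using prefix_length_le[OF u(2)] u length_U by metis
    then have "(2::nat) ^ k < 2 * 2 ^ j" using k by linarith
    then have "(2::nat) ^ k < 2 ^ Suc j" by simp
    then have "k \<le> j" using power_less_imp_less_exp[of "2::nat" k "Suc j"] by simp
    then have "take (2 ^ k) v \<in> U k" using take_in_U u by blast
    moreover have "u = take m (take (2 ^ k) v)"
      using u k by (auto simp: prefix_def min_def)
    ultimately show "u \<in> take m ` U k" by blast
  qed
  then have "finite {u\<in>heads. length u = m}" "card {u\<in>heads. length u = m} \<le> card (U k)"
    using finite_U by (meson finite_imageI finite_subset, meson card_image_le card_mono finite_imageI le_trans)
  moreover have "f (2 ^ k) \<le> f (2 * m)" using k by (intro f_mono) auto
  ultimately show ?thesis using card_U_le[of k] by linarith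
qed

lemma tails_of_length:
  assumes "1 \<le> m"
  shows "finite {u\<in>tails. length u = m} \<and> card {u\<in>tails. length u = m} \<le> 2 * f (2 * m)"
proof -
  obtain k where k: "m \<le> 2 ^ k" "2 ^ k < 2 * m" using exists_power_two_above[OF assms] by blast
  have "{u\<in>tails. length u = m} \<subseteq> drop (2 ^ k - m) ` U k"
  proof
    fix u assume "u \<in> {u\<in>tails. length u = m}"
    then obtain v j where u: "length u = m" "suffix u v" "v \<in> U j" unfolding tails_def blocks_def by blast
    have "m \<le> 2 ^ j" using suffix_length_le[OF u(2)] u length_U by metis
    then have "(2::nat) ^ k < 2 * 2 ^ j" using k by linarith
    then have "(2::nat) ^ k < 2 ^ Suc j" by simp
    then have kj: "k \<le> j" using power_less_imp_less_exp[of "2::nat" k "Suc j"] by simp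
    then have "drop (2 ^ j - 2 ^ k) v \<in> U k" using drop_in_U u by blast
    moreover have "u = drop (2 ^ k - m) (drop (2 ^ j - 2 ^ k) v)"
    proof -
      have "(2::nat) ^ k \<le> 2 ^ j" using kj by simp
      then have "2 ^ k - m + (2 ^ j - 2 ^ k) = length v - m" using k length_U[OF u(3)] by simp
      then show ?thesis using u by (auto simp: suffix_def add.commute)
    qed
    ultimately show "u \<in> drop (2 ^ k - m) ` U k" by blast
  qed
  then have "finite {u\<in>tails. length u = m}" "card {u\<in>tails. length u = m} \<le> card (U k)"
    using finite_U by (meson finite_imageI finite_subset, meson card_image_le card_mono finite_imageI le_trans)
  moreover have "f (2 ^ k) \<le> f (2 * m)" using k by (intro f_mono) auto
  ultimately show ?thesis using card_U_le[of k] by linarith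
qed

lemma card_adjacent_pairs: "finite (adjacent_pairs k)" "card (adjacent_pairs k) \<le> 4 * f (2 * 2 ^ k)"
proof -
  have finC: "finite (C k)" using C_subset finite_U finite_subset by metis
  show "finite (adjacent_pairs k)" unfolding adjacent_pairs_def using finC finite_U by simp
  have "card (U (Suc k)) = card (C k) * card (U k)" unfolding U_Suc
    using C_subset[of k] length_U by (intro card_concats) blast+
  then have "card (adjacent_pairs k) \<le> 2 * card (U (Suc k))" unfolding adjacent_pairs_def
    using card_Un_le[of "C k \<times> U k" "U k \<times> C k"] by (simp add: card_cartesian_product mult.commute)
  then show "card (adjacent_pairs k) \<le> 4 * f (2 * 2 ^ k)" using card_U_le[of "Suc k"] by simp
qed

text \<open>A factor is given by a pair of adjacent blocks and a position in it. The position costs the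
additional \<open>m\<close> in comparison with prefixes and suffixes.\<close>
lemma factors_of_length:
  assumes "1 \<le> m"
  shows "finite {u\<in>factors. length u = m} \<and> card {u\<in>factors. length u = m} \<le> 16 * m * f (4 * m)"
proof -
  obtain k where k: "m \<le> 2 ^ k" "2 ^ k < 2 * m" using exists_power_two_above[OF assms] by blast
  let ?g = "\<lambda>(i, p, q). take m (drop i (p @ q))"
  let ?D = "{..< 2 * 2 ^ k :: nat} \<times> adjacent_pairs k"
  have "{u\<in>factors. length u = m} \<subseteq> ?g ` ?D"
  proof
    fix u assume u: "u \<in> {u\<in>factors. length u = m}"
    then obtain p q where pq: "(p, q) \<in> adjacent_pairs k" "sublist u (p @ q)"
      using factor_in_adjacent_pair[of u _ k] k unfolding factors_def by blast
    then obtain x y where xy: "p @ q = x @ u @ y" unfolding sublist_def by blast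
    have "length (p @ q) = 2 * 2 ^ k"
      using pq(1) C_subset[of k] length_U unfolding adjacent_pairs_def by (auto simp: subset_iff)
    then have "length x + length u \<le> 2 * 2 ^ k" using xy by simp
    then have "length x < 2 * 2 ^ k" using u assms by auto
    moreover have "u = ?g (length x, p, q)" using u unfolding case_prod_conv xy by simp
    ultimately show "u \<in> ?g ` ?D" using pq(1) by (intro image_eqI[of _ _ "(length x, p, q)"]) auto
  qed
  moreover have finD: "finite ?D" using card_adjacent_pairs by simp
  ultimately have "finite {u\<in>factors. length u = m}" "card {u\<in>factors. length u = m} \<le> card ?D"
    by (meson finite_imageI finite_subset, meson card_image_le card_mono finite_imageI le_trans)
  moreover have "card ?D \<le> 16 * m * f (4 * m)"
  proof -
    have "f (2 * 2 ^ k) \<le> f (4 * m)" using k by (intro f_mono) auto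
    then have "card (adjacent_pairs k) \<le> 4 * f (4 * m)"
      using card_adjacent_pairs(2)[of k] by linarith
    moreover have "2 * 2 ^ k \<le> 4 * m" using k by linarith
    ultimately have "2 * 2 ^ k * card (adjacent_pairs k) \<le> (4 * m) * (4 * f (4 * m))"
      by (rule mult_le_mono[rotated])
    then show ?thesis by (simp add: card_cartesian_product)
  qed
  ultimately show ?thesis by linarith
qed

end

section \<open>Landing positions for the jumps\<close>

text \<open>Below its landing position each block reserves as many vertices of the ray as it has nonempty suffixes,
one for each \<open>drop i v\<close>. The disjointness of these segments bounds the number of words
that can jump to a vertex near to the root, together with their suffixes; on the other hand, the
segments are packed densely enough for \<open>N v\<close> to be at most \<open>4 * length v * f (length v)\<close>.\<close>
locale returning_graph = block_language +
  fixes N :: "nat list \<Rightarrow> nat"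
  assumes length_le_N: "v \<in> blocks \<Longrightarrow> length v \<le> N v"
    and N_inj: "\<lbrakk>v \<in> blocks; v' \<in> blocks; i < length v; i' < length v'; N v - i = N v' - i'\<rbrakk>
       \<Longrightarrow> v = v' \<and> i = i'"
    and N_le: "v \<in> U k \<Longrightarrow> N v \<le> 4 * 2 ^ k * f (2 ^ k)"

context block_language
begin

lemma U_in_blocks: "v \<in> U k \<Longrightarrow> v \<in> blocks" unfolding blocks_def by blast

text \<open>The segments of length \<open>2 ^ k\<close> for the elements of \<open>U k\<close> are laid out one after the other, level by level.\<close>
lemma return_positions_exist:
  "\<exists>N. returning_graph f U C N"
proof -
  obtain h where h: "\<And>k. bij_betw (h k) (U k) {0..<card (U k)}"
    using ex_bij_betw_finite_nat[OF finite_U] by metis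
  define base where "base k = (\<Sum>j<k. 2 ^ j * card (U j))" for k
  define level where "level v = (THE k. length v = 2 ^ k)" for v :: "nat list"
  define N where "N v = base (level v) + 2 ^ level v * (h (level v) v + 1)" for v
  have level: "level v = k" if "v \<in> U k" for v k
    unfolding level_def using length_U[OF that] by (intro the_equality) auto
  have hlt: "h k v < card (U k)" if "v \<in> U k" for v k
    using bij_betwE[OF h] that by auto
  have pos: "\<exists>x<2 ^ k. N v - i = base k + (2 ^ k * h k v + x) + 1 \<and> x + i + 1 = 2 ^ k"
    if "v \<in> U k" "i < 2 ^ k" for v k i
  proof (intro exI[of _ "2 ^ k - 1 - i"] conjI)
    have "N v = base k + (2 ^ k * h k v + 2 ^ k)"
      unfolding N_def level[OF that(1)] by (simp add: distrib_left)
    then show "N v - i = base k + (2 ^ k * h k v + (2 ^ k - 1 - i)) + 1" using that(2) by linarith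
  qed (use that(2) in linarith)+
  have base_mono: "base k \<le> base k'" if "k \<le> k'" for k k'
    unfolding base_def using that by (intro sum_mono2) auto
  have inside: "2 ^ k * h k v + x < 2 ^ k * card (U k)" if "v \<in> U k" "x < 2 ^ k" for k v x
  proof -
    have "2 ^ k * h k v + x < 2 ^ k * (h k v + 1)" using that by simp
    also have "\<dots> \<le> 2 ^ k * card (U k)" using hlt[OF that(1)] by (intro mult_le_mono2) simp
    finally show ?thesis .
  qed
  have inj: "v = v' \<and> i = i'"
    if v: "v \<in> U k" "v' \<in> U k'" "i < length v" "i' < length v'" "N v - i = N v' - i'" for v v' i i' k k'
  proof -
    have il: "i < 2 ^ k" "i' < 2 ^ k'" using v length_U by auto
    obtain x where x: "x < 2 ^ k" "N v - i = base k + (2 ^ k * h k v + x) + 1" "x + i + 1 = 2 ^ k"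
      using pos[OF v(1) il(1)] by blast
    obtain x' where x': "x' < 2 ^ k'" "N v' - i' = base k' + (2 ^ k' * h k' v' + x') + 1" "x' + i' + 1 = 2 ^ k'"
      using pos[OF v(2) il(2)] by blast
    have lt: "N w - j \<le> base (Suc l)" if "w \<in> U l" "j < 2 ^ l" for w l j
    proof -
      obtain y where y: "y < 2 ^ l" "N w - j = base l + (2 ^ l * h l w + y) + 1" using pos[OF \<open>w \<in> U l\<close> \<open>j < 2 ^ l\<close>] by blast
      then have "N w - j \<le> base l + 2 ^ l * card (U l)" using inside[OF \<open>w \<in> U l\<close> y(1)] by linarith
      then show ?thesis by (simp add: base_def)
    qed
    have gt: "base l < N w - j" if "w \<in> U l" "j < 2 ^ l" for w l j
      using pos[OF that] by auto
    have "k = k'"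
    proof (rule ccontr)
      assume "k \<noteq> k'"
      then consider "Suc k \<le> k'" | "Suc k' \<le> k" by linarith
      then show False
        using lt[OF v(1) il(1)] gt[OF v(1) il(1)] lt[OF v(2) il(2)] gt[OF v(2) il(2)] v(5)
          base_mono[of "Suc k" k'] base_mono[of "Suc k'" k] by cases linarith+
    qed
    then have eq: "2 ^ k * h k v + x = 2 ^ k * h k v' + x'" using x x' v(5) by simp
    have "h k v = (2 ^ k * h k v + x) div 2 ^ k" "h k v' = (2 ^ k * h k v' + x') div 2 ^ k"
      using x(1) x'(1) \<open>k = k'\<close> by simp_all
    then have hh: "h k v = h k v'" using eq by simp
    then have "v = v'" using h[of k] v \<open>k = k'\<close> unfolding bij_betw_def inj_on_def by blast
    moreover have "x = x'" using eq hh by simp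
    then have "i = i'" using x(3) x'(3) \<open>k = k'\<close> by simp
    ultimately show ?thesis by blast
  qed
  have ge: "length v \<le> N v" if "v \<in> U k" for v k
    using length_U[OF that] unfolding N_def level[OF that] by simp
  have le: "N v \<le> 4 * 2 ^ k * f (2 ^ k)" if "v \<in> U k" for v k
  proof -
    have "2 ^ k * (h k v + 1) \<le> 2 ^ k * card (U k)" using hlt[OF that] by (intro mult_le_mono2) simp
    then have "N v \<le> base (Suc k)" unfolding N_def level[OF that] base_def by simp
    also have "\<dots> \<le> (\<Sum>j<Suc k. 2 ^ j * (2 * f (2 ^ k)))" unfolding base_def
    proof (intro sum_mono mult_le_mono2)
      fix j assume "j \<in> {..<Suc k}"
      then have "f (2 ^ j) \<le> f (2 ^ k)" by (intro f_mono) auto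
      then show "card (U j) \<le> 2 * f (2 ^ k)" using card_U_le[of j] by linarith
    qed
    also have "\<dots> = (2 ^ Suc k - 1) * (2 * f (2 ^ k))"
      unfolding sum_distrib_right[symmetric] lessThan_atLeast0 sum_power2 ..
    also have "\<dots> \<le> 2 ^ Suc k * (2 * f (2 ^ k))" by (intro mult_le_mono1) simp
    finally show ?thesis by simp
  qed
  have "returning_graph f U C N"
  proof
    show "v = v' \<and> i = i'" if blocks: "v \<in> blocks" "v' \<in> blocks"
      and *: "i < length v" "i' < length v'" "N v - i = N v' - i'" for v v' i i'
    proof -
      obtain k k' where "v \<in> U k" "v' \<in> U k'" using blocks unfolding blocks_def by blast
      then show ?thesis using inj * by blast
    qed
    show "length v \<le> N v" if "v \<in> blocks" for v
      using that ge unfolding blocks_def by blast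
  qed (rule le)
  then show ?thesis by blast
qed

lemma Nil_notin_blocks: "[] \<notin> blocks" using length_U unfolding blocks_def by fastforce

lemma zero_notin_tails: "w \<in> tails \<Longrightarrow> 0 \<notin> set w"
  using zero_notin_U set_mono_suffix unfolding tails_def blocks_def by blast

lemma blocks_subset_tails: "blocks \<subseteq> tails" unfolding tails_def by auto

lemma Nil_in_tails: "[] \<in> tails" using U_nonempty[of 0] unfolding tails_def blocks_def by auto

lemma tails_suffix_closed: "u @ w \<in> tails \<Longrightarrow> w \<in> tails"
  unfolding tails_def by (auto intro: suffix_appendD)

lemma replicate_zero_in_tails: "replicate i 0 \<in> tails \<longleftrightarrow> i = 0"
  using zero_notin_tails[of "replicate i 0"] Nil_in_tails by (cases "i = 0") auto

lemma replicate_zero_notin_blocks: "replicate i 0 \<notin> blocks"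
  using replicate_zero_in_tails blocks_subset_tails Nil_notin_blocks by (cases "i = 0") auto

end

section \<open>The graph and its partial injections\<close>

datatype gen = Up nat | Down | Jump

context returning_graph
begin

definition vertices :: "nat list set" where
  "vertices = tails \<union> range (\<lambda>i. replicate i 0)"

lemma replicate_zero_in_vertices: "replicate i 0 \<in> vertices" unfolding vertices_def by blast

lemma Cons_replicate_zero_in_vertices: "0 # replicate i 0 \<in> vertices"
  using replicate_zero_in_vertices[of "Suc i"] by simp

fun step :: "gen \<Rightarrow> nat list \<Rightarrow> nat list option" where
  "step (Up a) s = (if a # s \<in> tails then Some (a # s) else None)"
| "step Down s = (if \<exists>i. s = replicate (Suc i) 0 then Some (tl s) else None)"
| "step Jump s = (if s \<in> blocks then Some (replicate (N s) 0) else None)"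

text \<open>A word acts from right to left. The empty word is the identity on the vertices only, since the matrices
below have no entries outside of the graph.\<close>
fun act :: "gen list \<Rightarrow> nat list \<Rightarrow> nat list option" where
  "act [] s = (if s \<in> vertices then Some s else None)"
| "act (g # \<alpha>) s = (step g \<circ>\<^sub>m act \<alpha>) s"

declare act.simps(2)[simp del]

lemma act_Cons: "act (g # \<alpha>) = step g \<circ>\<^sub>m act \<alpha>" by (rule ext) (rule act.simps)

lemma step_vertices: "step g s = Some t \<Longrightarrow> s \<in> vertices \<and> t \<in> vertices"
proof (cases g)
  case (Up a)
  then show "step g s = Some t \<Longrightarrow> s \<in> vertices \<and> t \<in> vertices"
    using tails_suffix_closed[of "[a]" s] by (auto simp: vertices_def split: if_splits)
next
  case Down
  assume "step g s = Some t"
  then obtain i where "s = replicate (Suc i) 0" "t = replicate i 0" using Down by (auto split: if_splits)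
  then show ?thesis unfolding vertices_def by blast
next
  case Jump
  then show "step g s = Some t \<Longrightarrow> s \<in> vertices \<and> t \<in> vertices"
    using blocks_subset_tails by (auto simp: vertices_def split: if_splits)
qed

lemma N_eq_imp_eq: "v \<in> blocks \<Longrightarrow> v' \<in> blocks \<Longrightarrow> N v = N v' \<Longrightarrow> v = v'"
  using N_inj[of v v' 0 0] Nil_notin_blocks by fastforce

lemma step_inj: "step g s = Some t \<Longrightarrow> step g s' = Some t \<Longrightarrow> s = s'"
proof (cases g)
  case Jump
  assume "step g s = Some t" "step g s' = Some t"
  then have "s \<in> blocks" "s' \<in> blocks" "replicate (N s) (0::nat) = replicate (N s') 0"
    using Jump by (auto split: if_splits)
  then show "s = s'" using N_eq_imp_eq by (metis length_replicate)
qed (auto split: if_splits)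

lemma act_vertices: "act \<alpha> s = Some t \<Longrightarrow> s \<in> vertices \<and> t \<in> vertices"
  by (induction \<alpha> arbitrary: t) (auto simp: act_Cons map_comp_Some_iff dest: step_vertices split: if_splits)

lemma act_inj: "act \<alpha> s = Some t \<Longrightarrow> act \<alpha> s' = Some t \<Longrightarrow> s = s'"
proof (induction \<alpha> arbitrary: t)
  case Nil
  then show ?case by (simp split: if_splits)
next
  case (Cons g \<alpha>)
  then obtain r r' where "act \<alpha> s = Some r" "step g r = Some t" "act \<alpha> s' = Some r'" "step g r' = Some t"
    unfolding act_Cons map_comp_Some_iff by blast
  then show ?case using Cons.IH step_inj by metis
qed

lemma act_append: "act (\<beta> @ \<alpha>) = act \<beta> \<circ>\<^sub>m act \<alpha>"
proof (induction \<beta>)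
  case Nil
  show ?case by (rule ext) (auto simp: map_comp_def dest: act_vertices split: option.splits)
next
  case (Cons g \<beta>)
  then show ?case by (auto simp: act_Cons map_comp_def fun_eq_iff split: option.splits)
qed

text \<open>The shapes that a product of generators can take: prepending \<open>u\<close>, with the identity for \<open>u = []\<close>;
then a jump and \<open>k\<close> steps down; only steps down.\<close>
definition walk :: "nat list \<Rightarrow> nat list \<Rightarrow> nat list option" where
  "walk u s = (if u @ s \<in> (if u = [] then vertices else tails) then Some (u @ s) else None)"

definition jump :: "nat \<Rightarrow> nat list \<Rightarrow> nat list \<Rightarrow> nat list option" where
  "jump k u s = (if u @ s \<in> blocks \<and> k \<le> N (u @ s) then Some (replicate (N (u @ s) - k) 0) else None)"

definition descend :: "nat \<Rightarrow> nat list \<Rightarrow> nat list option" where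
  "descend k s = (if \<exists>i. s = replicate (k + i) 0 then Some (drop k s) else None)"

text \<open>Supersets of the vertices from which the root can be reached in \<open>n\<close> steps, and of those that can be reached
from the root in \<open>n\<close> steps. The second one admits a whole initial segment of the ray, with the
length \<open>4 * n * f n\<close> given by the bound on \<open>N\<close>.\<close>
definition sources :: "nat \<Rightarrow> nat list set" where
  "sources n = (\<lambda>i. replicate i 0) ` {..n} \<union> {s. \<exists>u. u @ s \<in> blocks \<and> N (u @ s) \<le> n}"

definition targets :: "nat \<Rightarrow> nat list set" where
  "targets n = {t\<in>tails. length t \<le> n} \<union> (\<lambda>i. replicate i 0) ` {..4 * n * f n}"

definition transformations :: "nat \<Rightarrow> (nat list \<Rightarrow> nat list option) set" where
  "transformations n = {Map.empty} \<union> walk ` {u\<in>factors. length u \<le> n}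
     \<union> (\<lambda>(k, u). jump k u) ` ({..n} \<times> {u\<in>heads. length u \<le> n})
     \<union> descend ` {..n} \<union> (\<lambda>(s, t). [s \<mapsto> t]) ` (sources n \<times> targets n)"

lemma walk_in: "length u \<le> n \<Longrightarrow> walk u \<in> transformations n"
proof (cases "u \<in> factors")
  case True
  then show "length u \<le> n \<Longrightarrow> ?thesis" unfolding transformations_def by blast
next
  case False
  have "walk u = Map.empty"
  proof
    fix s
    have "u \<noteq> []" using False U_nonempty[of 0] unfolding factors_def blocks_def by auto
    moreover have "u @ s \<notin> tails"
    proof
      assume "u @ s \<in> tails"
      then obtain v where "v \<in> blocks" "sublist (u @ s) v" unfolding tails_def by blast
      moreover from this have "sublist u v"
        using sublist_order.order_trans[OF sublist_append_rightI] by blast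
      ultimately show False using False unfolding factors_def by blast
    qed
    ultimately show "walk u s = None" unfolding walk_def by simp
  qed
  then show ?thesis unfolding transformations_def by blast
qed

lemma jump_in: "k \<le> n \<Longrightarrow> length u \<le> n \<Longrightarrow> jump k u \<in> transformations n"
proof (cases "u \<in> heads")
  case True
  then show "k \<le> n \<Longrightarrow> length u \<le> n \<Longrightarrow> ?thesis" unfolding transformations_def by blast
next
  case False
  have "jump k u = Map.empty"
  proof
    fix s
    have "u @ s \<notin> blocks" using False unfolding heads_def by (auto simp: prefix_def)
    then show "jump k u s = None" unfolding jump_def by simp
  qed
  then show ?thesis unfolding transformations_def by blast
qed

lemma descend_in: "k \<le> n \<Longrightarrow> descend k \<in> transformations n"
  unfolding transformations_def by blast

lemma point_in: "s \<in> sources n \<Longrightarrow> t \<in> targets n \<Longrightarrow> [s \<mapsto> t] \<in> transformations n"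
  unfolding transformations_def by (intro UnI2 image_eqI[of _ _ "(s, t)"]) auto

lemma empty_in: "Map.empty \<in> transformations n"
  unfolding transformations_def by blast

lemma Cons_replicate_zero_in_tails: "a # replicate i 0 \<in> tails \<longleftrightarrow> i = 0 \<and> [a] \<in> tails"
  using zero_notin_tails[of "a # replicate i 0"] by (cases i) auto

lemma length_N_le: "v \<in> blocks \<Longrightarrow> length v \<le> n \<Longrightarrow> N v \<le> 4 * n * f n"
proof -
  assume v: "v \<in> blocks" "length v \<le> n"
  then obtain k where k: "v \<in> U k" unfolding blocks_def by blast
  then have "2 ^ k \<le> n" using v length_U by auto
  then have "f (2 ^ k) \<le> f n" by (intro f_mono) auto
  have "N v \<le> 4 * 2 ^ k * f (2 ^ k)" using N_le k by blast
  also have "\<dots> \<le> 4 * n * f n" using \<open>2 ^ k \<le> n\<close> \<open>f (2 ^ k) \<le> f n\<close> by (intro mult_le_mono) auto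
  finally show ?thesis .
qed

lemma targets_step: "t \<in> targets n \<Longrightarrow> step g t = Some t' \<Longrightarrow> t' \<in> targets (Suc n)"
proof -
  assume t: "t \<in> targets n" "step g t = Some t'"
  have mono: "4 * n * f n \<le> 4 * Suc n * f (Suc n)"
  proof (cases "n = 0")
    case False
    then have "f n \<le> f (Suc n)" by (intro f_mono) auto
    then show ?thesis by (intro mult_le_mono) auto
  qed simp
  show ?thesis
  proof (cases g)
    case (Up a)
    then have t': "t' = a # t" "a # t \<in> tails" using t by (auto split: if_splits)
    then have "length t \<le> n"
      using t(1) unfolding targets_def by (auto simp: Cons_replicate_zero_in_tails)
    then show ?thesis using t' unfolding targets_def by simp
  next
    case Down
    then obtain i where i: "t = replicate (Suc i) 0" "t' = replicate i 0"
      using t by (auto split: if_splits)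
    then have "t \<notin> tails" using replicate_zero_in_tails by blast
    then obtain j where j: "j \<le> 4 * n * f n" "t = replicate j 0"
      using t(1) unfolding targets_def by blast
    then have "j = Suc i" using i by (metis length_replicate)
    then have "i \<le> 4 * Suc n * f (Suc n)" using j mono by linarith
    then show ?thesis using i unfolding targets_def by blast
  next
    case Jump
    then have t': "t' = replicate (N t) 0" "t \<in> blocks" using t by (auto split: if_splits)
    then have "length t \<le> n"
      using t(1) replicate_zero_notin_blocks unfolding targets_def by auto
    then have "N t \<le> 4 * Suc n * f (Suc n)" using length_N_le[OF t'(2), of n] mono by linarith
    then show ?thesis using t' unfolding targets_def by blast
  qed
qed

lemma sources_mono: "m \<le> n \<Longrightarrow> sources m \<subseteq> sources n"
  unfolding sources_def by auto

lemma step_walk: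
  assumes "length u \<le> n"
  shows "step g \<circ>\<^sub>m walk u \<in> transformations (Suc n)"
proof (cases g)
  case (Up a)
  have "step g \<circ>\<^sub>m walk u = walk (a # u)"
  proof
    fix s
    show "(step g \<circ>\<^sub>m walk u) s = walk (a # u) s"
      using tails_suffix_closed[of "[a]" "u @ s"]
      by (auto simp: Up walk_def map_comp_def vertices_def)
  qed
  then show ?thesis using walk_in[of "a # u" "Suc n"] assms by simp
next
  case Down
  show ?thesis
  proof (cases "u = []")
    case True
    have "step g \<circ>\<^sub>m walk u = descend 1"
      by (rule ext) (auto simp: Down True walk_def map_comp_def descend_def Cons_replicate_zero_in_vertices)
    then show ?thesis using descend_in[of 1 "Suc n"] by simp
  next
    case False
    have "step g \<circ>\<^sub>m walk u = Map.empty"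
    proof
      fix s
      have "\<not> (\<exists>i. u @ s = replicate (Suc i) 0)" if "u @ s \<in> tails"
      proof
        assume "\<exists>i. u @ s = replicate (Suc i) 0"
        then have "0 \<in> set (u @ s)" by (auto simp del: set_append)
        then show False using zero_notin_tails[OF that] by blast
      qed
      then show "(step g \<circ>\<^sub>m walk u) s = None"
        using False by (auto simp del: replicate.simps simp: Down walk_def map_comp_def)
    qed
    then show ?thesis using empty_in by simp
  qed
next
  case Jump
  have "step g \<circ>\<^sub>m walk u = jump 0 u"
    by (rule ext) (use blocks_subset_tails in \<open>auto simp: Jump walk_def map_comp_def vertices_def jump_def\<close>)
  then show ?thesis using jump_in[of 0 "Suc n" u] assms by simp
qed

text \<open>The map \<open>jump k u\<close> is followed by a move into the tree only at the root, where \<open>N (u @ s) = k\<close>. As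
\<open>N\<close> is injective, this happens for one \<open>s\<close> at most and the rank drops to one.\<close>
lemma step_jump:
  assumes "length u \<le> n" "k \<le> n"
  shows "step g \<circ>\<^sub>m jump k u \<in> transformations (Suc n)"
proof (cases g)
  case (Up a)
  show ?thesis
  proof (cases "\<exists>s. u @ s \<in> blocks \<and> N (u @ s) = k \<and> [a] \<in> tails")
    case True
    then obtain s0 where s0: "u @ s0 \<in> blocks" "N (u @ s0) = k" "[a] \<in> tails" by blast
    have "step g \<circ>\<^sub>m jump k u = [s0 \<mapsto> [a]]"
    proof
      fix s
      have unique: "s = s0" if "u @ s \<in> blocks" "N (u @ s) = k"
        using N_eq_imp_eq[OF that(1) s0(1)] that s0 by simp
      show "(step g \<circ>\<^sub>m jump k u) s = [s0 \<mapsto> [a]] s"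
      proof (cases "s = s0")
        case True
        then show ?thesis using s0 by (simp add: Up jump_def map_comp_def)
      next
        case False
        then have "\<not> (u @ s \<in> blocks \<and> N (u @ s) = k)" using unique by blast
        then show ?thesis using False
          by (auto simp: Up jump_def map_comp_def Cons_replicate_zero_in_tails)
      qed
    qed
    moreover have "s0 \<in> sources (Suc n)" using s0 assms unfolding sources_def by fastforce
    moreover have "[a] \<in> targets (Suc n)" using s0 unfolding targets_def by simp
    ultimately show ?thesis using point_in by simp
  next
    case False
    have "step g \<circ>\<^sub>m jump k u = Map.empty"
      by (rule ext) (use False in \<open>auto simp: Up jump_def map_comp_def Cons_replicate_zero_in_tails\<close>)
    then show ?thesis using empty_in by simp
  qed
next
  case Down
  have "step g \<circ>\<^sub>m jump k u = jump (Suc k) u"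
  proof
    fix s
    show "(step g \<circ>\<^sub>m jump k u) s = jump (Suc k) u s"
    proof (cases "Suc k \<le> N (u @ s)")
      case True
      then obtain j where "N (u @ s) - k = Suc j" "N (u @ s) - Suc k = j"
        by (metis Suc_diff_Suc Suc_le_lessD)
      then show ?thesis using True by (auto simp: Down jump_def map_comp_def)
    next
      case False
      then show ?thesis by (auto simp: Down jump_def map_comp_def)
    qed
  qed
  then show ?thesis using jump_in[of "Suc k" "Suc n" u] assms by simp
next
  case Jump
  have "step g \<circ>\<^sub>m jump k u = Map.empty"
    by (rule ext) (auto simp: Jump jump_def map_comp_def replicate_zero_notin_blocks)
  then show ?thesis using empty_in by simp
qed

lemma descend_replicate: "descend k (replicate (k + i) 0) = Some (replicate i 0)"
  unfolding descend_def by auto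

lemma step_descend:
  assumes "k \<le> n"
  shows "step g \<circ>\<^sub>m descend k \<in> transformations (Suc n)"
proof (cases g)
  case (Up a)
  show ?thesis
  proof (cases "[a] \<in> tails")
    case True
    have "step g \<circ>\<^sub>m descend k = [replicate k 0 \<mapsto> [a]]"
      by (rule ext) (use True in \<open>auto simp: Up descend_def map_comp_def Cons_replicate_zero_in_tails\<close>)
    moreover have "replicate k 0 \<in> sources (Suc n)" using assms unfolding sources_def by auto
    moreover have "[a] \<in> targets (Suc n)" using True unfolding targets_def by simp
    ultimately show ?thesis using point_in by simp
  next
    case False
    have "step g \<circ>\<^sub>m descend k = Map.empty"
      by (rule ext) (use False in \<open>auto simp: Up descend_def map_comp_def Cons_replicate_zero_in_tails\<close>)
    then show ?thesis using empty_in by simp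
  qed
next
  case Down
  have "step g \<circ>\<^sub>m descend k = descend (Suc k)"
  proof
    fix s
    show "(step g \<circ>\<^sub>m descend k) s = descend (Suc k) s"
    proof (cases "\<exists>i. s = replicate (k + i) 0")
      case True
      then obtain i where s: "s = replicate (k + i) 0" by blast
      show ?thesis
      proof (cases i)
        case 0
        have "\<not> (\<exists>j. replicate k 0 = replicate (Suc k + j) (0::nat))"
          by (metis length_replicate less_add_Suc1 add_Suc less_irrefl)
        then have "descend (Suc k) s = None" unfolding descend_def s 0 add_0_right by simp
        moreover have "step Down [] = None" by simp
        ultimately show ?thesis unfolding map_comp_def s descend_replicate Down 0 by simp
      next
        case (Suc j)
        have "descend (Suc k) s = Some (replicate j 0)"
          unfolding s Suc add_Suc_shift[symmetric] by (rule descend_replicate)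
        then show ?thesis unfolding map_comp_def s descend_replicate Down Suc by simp
      qed
    next
      case False
      then have "\<not> (\<exists>i. s = replicate (Suc k + i) 0)" by (metis add_Suc_shift)
      then show ?thesis using False by (auto simp: Down descend_def map_comp_def)
    qed
  qed
  then show ?thesis using descend_in[of "Suc k" "Suc n"] assms by simp
next
  case Jump
  have "step g \<circ>\<^sub>m descend k = Map.empty"
    by (rule ext) (auto simp: Jump descend_def map_comp_def replicate_zero_notin_blocks)
  then show ?thesis using empty_in by simp
qed

lemma step_transformations:
  assumes "p \<in> transformations n"
  shows "step g \<circ>\<^sub>m p \<in> transformations (Suc n)"
proof -
  consider "p = Map.empty" | u where "p = walk u" "length u \<le> n"
    | k u where "p = jump k u" "k \<le> n" "length u \<le> n" | k where "p = descend k" "k \<le> n"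
    | s t where "p = [s \<mapsto> t]" "s \<in> sources n" "t \<in> targets n"
  proof -
    consider "p \<in> {Map.empty}" | "p \<in> walk ` {u\<in>factors. length u \<le> n}"
      | "p \<in> (\<lambda>(k, u). jump k u) ` ({..n} \<times> {u\<in>heads. length u \<le> n})"
      | "p \<in> descend ` {..n}" | "p \<in> (\<lambda>(s, t). [s \<mapsto> t]) ` (sources n \<times> targets n)"
      using assms unfolding transformations_def Un_iff by argo
    then show thesis
    proof cases
      case 1 then show thesis using that(1) by simp
    next
      case 2 then show thesis using that(2) by blast
    next
      case 3 then show thesis using that(3) by auto
    next
      case 4 then show thesis using that(4) by auto
    next
      case 5 then show thesis using that(5) by auto
    qed
  qed
  then show ?thesis
  proof cases
    case 1 then show ?thesis using empty_in by simp
  next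
    case 2 then show ?thesis using step_walk by blast
  next
    case 3 then show ?thesis using step_jump by blast
  next
    case 4 then show ?thesis using step_descend by blast
  next
    case 5
    show ?thesis
    proof (cases "step g t")
      case None
      then have "step g \<circ>\<^sub>m p = Map.empty" using 5 by (auto simp: map_comp_def fun_eq_iff)
      then show ?thesis using empty_in by simp
    next
      case (Some t')
      then have "step g \<circ>\<^sub>m p = [s \<mapsto> t']" using 5 by (auto simp: map_comp_def fun_eq_iff)
      moreover have "s \<in> sources (Suc n)" using 5 sources_mono[of n "Suc n"] by auto
      ultimately show ?thesis using point_in targets_step[OF 5(3) Some] by simp
    qed
  qed
qed

lemma act_in_transformations: "act \<alpha> \<in> transformations (length \<alpha>)"
proof (induction \<alpha>)
  case Nil
  have "act [] = walk []" by (rule ext) (simp add: walk_def)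
  then show ?case using walk_in[of "[]" 0] by simp
next
  case (Cons g \<alpha>)
  then show ?case unfolding act_Cons using step_transformations by simp
qed

lemma targets_mono: "m \<le> n \<Longrightarrow> targets m \<subseteq> targets n"
proof -
  assume "m \<le> n"
  have "4 * m * f m \<le> 4 * n * f n"
  proof (cases "m = 0")
    case False
    then have "f m \<le> f n" using \<open>m \<le> n\<close> by (intro f_mono) auto
    then show ?thesis using \<open>m \<le> n\<close> by (intro mult_le_mono) auto
  qed simp
  then have "{..4 * m * f m} \<subseteq> {..4 * n * f n}" by auto
  moreover have "{t\<in>tails. length t \<le> m} \<subseteq> {t\<in>tails. length t \<le> n}" using \<open>m \<le> n\<close> by auto
  ultimately show ?thesis unfolding targets_def by (intro Un_mono image_mono)
qed

lemma transformations_mono: "m \<le> n \<Longrightarrow> transformations m \<subseteq> transformations n"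
proof -
  assume mn: "m \<le> n"
  have "{u\<in>factors. length u \<le> m} \<subseteq> {u\<in>factors. length u \<le> n}"
    "{u\<in>heads. length u \<le> m} \<subseteq> {u\<in>heads. length u \<le> n}" using mn by auto
  then show ?thesis unfolding transformations_def
    by (intro Un_mono image_mono Sigma_mono sources_mono targets_mono mn) (use mn in auto)
qed

text \<open>A nonempty word \<open>s\<close> that is completed to a block \<open>u @ s\<close> with \<open>N (u @ s) \<le> n\<close> is mapped to the position
\<open>N (u @ s) - length u\<close> in the segment of that block. This is injective into \<open>{..n}\<close>.\<close>
lemma sources_card: "finite (sources n) \<and> card (sources n) \<le> 2 * n + 2"
proof -
  define S where "S = {s. s \<noteq> [] \<and> (\<exists>u. u @ s \<in> blocks \<and> N (u @ s) \<le> n)}"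
  obtain h where h: "\<And>s. s \<in> S \<Longrightarrow> h s @ s \<in> blocks \<and> N (h s @ s) \<le> n"
  proof -
    have "\<forall>s\<in>S. \<exists>u. u @ s \<in> blocks \<and> N (u @ s) \<le> n" unfolding S_def by blast
    then show thesis using that by (metis (no_types))
  qed
  let ?g = "\<lambda>s. N (h s @ s) - length (h s)"
  have "inj_on ?g S"
  proof (rule inj_onI)
    fix s s' assume s: "s \<in> S" "s' \<in> S" "?g s = ?g s'"
    then have "h s @ s = h s' @ s' \<and> length (h s) = length (h s')"
      using h by (intro N_inj) (auto simp: S_def)
    then show "s = s'" by auto
  qed
  moreover have "?g ` S \<subseteq> {..n}" using h by fastforce
  ultimately have S: "finite S" "card S \<le> n + 1"
    using inj_on_finite[of ?g S "{..n}"] card_inj_on_le[of ?g S "{..n}"] by auto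
  let ?R = "(\<lambda>i. replicate i (0::nat)) ` {..n} \<union> S"
  have "card ((\<lambda>i. replicate i (0::nat)) ` {..n}) \<le> n + 1"
    using card_image_le[of "{..n}" "\<lambda>i. replicate i (0::nat)"] by simp
  then have "card ?R \<le> 2 * n + 2"
    using S card_Un_le[of "(\<lambda>i. replicate i (0::nat)) ` {..n}" S] by linarith
  moreover have "sources n \<subseteq> ?R"
  proof
    fix s assume "s \<in> sources n"
    then show "s \<in> ?R" unfolding sources_def S_def by (cases "s = []") (auto intro: image_eqI[of _ _ 0])
  qed
  moreover have "finite ?R" using S by simp
  ultimately show ?thesis using card_mono finite_subset by (meson le_trans)
qed

lemma targets_card:
  assumes "1 \<le> n"
  shows "finite (targets n) \<and> card (targets n) \<le> 8 * n * f (4 * n)"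
proof -
  have t: "finite {t\<in>tails. length t \<le> n} \<and> card {t\<in>tails. length t \<le> n} \<le> 1 + n * (2 * f (4 * n))"
  proof (rule card_bounded_length)
    fix m assume "1 \<le> m" "m \<le> n"
    then have "f (2 * m) \<le> f (4 * n)" by (intro f_mono) auto
    then show "finite {u\<in>tails. length u = m} \<and> card {u\<in>tails. length u = m} \<le> 2 * f (4 * n)"
      using tails_of_length[OF \<open>1 \<le> m\<close>] by linarith
  qed
  have "f n \<le> f (4 * n)" using assms by (intro f_mono) auto
  then have "4 * n * f n \<le> 4 * n * f (4 * n)" by simp
  moreover have "card ((\<lambda>i. replicate i (0::nat)) ` {..4 * n * f n}) \<le> 4 * n * f n + 1"
    using card_image_le[of "{..4 * n * f n}" "\<lambda>i. replicate i (0::nat)"] by simp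
  ultimately have "card ((\<lambda>i. replicate i (0::nat)) ` {..4 * n * f n}) \<le> 4 * n * f (4 * n) + 1"
    by linarith
  then have "card (targets n) \<le> 6 * (n * f (4 * n)) + 2" unfolding targets_def
    using t card_Un_le[of "{t\<in>tails. length t \<le> n}" "(\<lambda>i. replicate i (0::nat)) ` {..4 * n * f n}"]
    by linarith
  moreover have "1 \<le> n * f (4 * n)" using assms f_pos by simp
  ultimately have "card (targets n) \<le> 8 * (n * f (4 * n))" by linarith
  moreover have "finite (targets n)" using t unfolding targets_def by simp
  ultimately show ?thesis by (simp add: mult.assoc)
qed

lemma transformations_card:
  assumes "1 \<le> n"
  shows "finite (transformations n) \<and> card (transformations n) \<le> 63 * (n\<^sup>2 * f (4 * n))"
proof -
  let ?F = "f (4 * n)" and ?G = "n\<^sup>2 * f (4 * n)"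
  have F1: "1 \<le> ?F" using f_pos assms by simp
  have nF: "n \<le> n * ?F" "1 \<le> n * ?F" "n * ?F \<le> ?G"
    using F1 assms by (auto simp: power2_eq_square)
  have fac: "finite {u\<in>factors. length u \<le> n} \<and> card {u\<in>factors. length u \<le> n} \<le> 1 + n * (16 * n * ?F)"
  proof (rule card_bounded_length)
    fix m assume m: "1 \<le> m" "m \<le> n"
    then have "f (4 * m) \<le> ?F" by (intro f_mono) auto
    then have "16 * m * f (4 * m) \<le> 16 * n * ?F" using m by (intro mult_le_mono) auto
    then show "finite {u\<in>factors. length u = m} \<and> card {u\<in>factors. length u = m} \<le> 16 * n * ?F"
      using factors_of_length[OF m(1)] by linarith
  qed
  have head: "finite {u\<in>heads. length u \<le> n} \<and> card {u\<in>heads. length u \<le> n} \<le> 1 + n * (2 * ?F)"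
  proof (rule card_bounded_length)
    fix m assume m: "1 \<le> m" "m \<le> n"
    then have "f (2 * m) \<le> ?F" by (intro f_mono) auto
    then show "finite {u\<in>heads. length u = m} \<and> card {u\<in>heads. length u = m} \<le> 2 * ?F"
      using heads_of_length[OF m(1)] by linarith
  qed
  have w: "card (walk ` {u\<in>factors. length u \<le> n}) \<le> 17 * ?G"
  proof -
    have "card (walk ` {u\<in>factors. length u \<le> n}) \<le> 1 + n * (16 * n * ?F)"
      using fac card_image_le le_trans by blast
    also have "\<dots> = 1 + 16 * ?G" by (simp add: power2_eq_square)
    finally show ?thesis using nF by linarith
  qed
  have j: "card ((\<lambda>(k, u). jump k u) ` ({..n} \<times> {u\<in>heads. length u \<le> n})) \<le> 6 * ?G"
  proof -
    have "card ((\<lambda>(k, u). jump k u) ` ({..n} \<times> {u\<in>heads. length u \<le> n}))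
        \<le> card ({..n} \<times> {u\<in>heads. length u \<le> n})" using head by (intro card_image_le) auto
    also have "\<dots> \<le> (2 * n) * (3 * (n * ?F))"
    proof -
      have "1 + n * (2 * ?F) \<le> 3 * (n * ?F)" using nF by simp
      then have "card {u\<in>heads. length u \<le> n} \<le> 3 * (n * ?F)" using head by linarith
      moreover have "card {..n} \<le> 2 * n" using assms by simp
      ultimately show ?thesis unfolding card_cartesian_product by (intro mult_le_mono)
    qed
    finally show ?thesis by (simp add: power2_eq_square)
  qed
  have d: "card (descend ` {..n}) \<le> 2 * ?G"
  proof -
    have "card (descend ` {..n}) \<le> n + 1" using card_image_le[of "{..n}" descend] by simp
    then show ?thesis using nF assms by linarith
  qed
  have p: "card ((\<lambda>(s, t). [s \<mapsto> t]) ` (sources n \<times> targets n)) \<le> 32 * ?G"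
  proof -
    have "card ((\<lambda>(s, t). [s \<mapsto> t]) ` (sources n \<times> targets n)) \<le> card (sources n \<times> targets n)"
      using sources_card targets_card[OF assms] by (intro card_image_le) auto
    also have "\<dots> \<le> (4 * n) * (8 * n * ?F)" unfolding card_cartesian_product
    proof (rule mult_le_mono)
      show "card (sources n) \<le> 4 * n" using sources_card[of n] assms by linarith
      show "card (targets n) \<le> 8 * n * ?F" using targets_card[OF assms] by blast
    qed
    finally show ?thesis by (simp add: power2_eq_square)
  qed
  have "card (transformations n) \<le> 1 + 17 * ?G + 6 * ?G + 2 * ?G + 32 * ?G"
    unfolding transformations_def
    by (intro order.trans[OF card_Un_le] add_mono w j d p) simp
  moreover have "finite (transformations n)"
    unfolding transformations_def using fac head sources_card targets_card[OF assms] by auto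
  ultimately show ?thesis using nF by linarith
qed

lemma act_up: "u @ s \<in> tails \<Longrightarrow> act (map Up u) s = Some (u @ s)"
proof (induction u)
  case Nil
  then show ?case by (simp add: vertices_def)
next
  case (Cons a u)
  then have "u @ s \<in> tails" using tails_suffix_closed[of "[a]" "u @ s"] by simp
  then show ?case using Cons by (simp add: act_Cons map_comp_def)
qed

lemma act_down: "act (replicate k Down) (replicate (k + i) 0) = Some (replicate i 0)"
proof (induction k arbitrary: i)
  case 0
  then show ?case using replicate_zero_in_vertices by simp
next
  case (Suc k)
  have "act (replicate k Down) (replicate (Suc k + i) 0) = Some (replicate (Suc i) 0)"
    using Suc[of "Suc i"] by (simp del: replicate.simps)
  then show ?case unfolding replicate_Suc[of k] act_Cons map_comp_def by simp
qed

text \<open>Every word of the tree can be completed to a block by prepending letters, and blocks can jump to the ray.\<close>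
lemma act_to_root: "s \<in> vertices \<Longrightarrow> \<exists>\<alpha>. act \<alpha> s = Some []"
proof -
  have down: "\<exists>\<alpha>. act \<alpha> (replicate i 0) = Some []" for i
    using act_down[of i 0] by auto
  assume "s \<in> vertices"
  then consider "s \<in> tails" | i where "s = replicate i 0" unfolding vertices_def by blast
  then show ?thesis
  proof cases
    case 1
    then obtain u where u: "u @ s \<in> blocks" unfolding tails_def suffix_def by auto
    then have "act (Jump # map Up u) s = Some (replicate (N (u @ s)) 0)"
      using act_up[of u s] blocks_subset_tails by (auto simp: act_Cons map_comp_def)
    moreover obtain \<alpha> where "act \<alpha> (replicate (N (u @ s)) 0) = Some []" using down by blast
    ultimately have "act (\<alpha> @ Jump # map Up u) s = Some []" by (simp add: act_append map_comp_def)
    then show ?thesis by blast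
  next
    case 2
    then show ?thesis using down by blast
  qed
qed

lemma act_from_root: "t \<in> vertices \<Longrightarrow> \<exists>\<alpha>. act \<alpha> [] = Some t"
proof -
  assume "t \<in> vertices"
  then consider "t \<in> tails" | i where "t = replicate i 0" unfolding vertices_def by blast
  then show ?thesis
  proof cases
    case 1
    then show ?thesis using act_up[of t "[]"] by auto
  next
    case 2
    obtain v where v: "v \<in> U i" using U_nonempty by blast
    then have vb: "v \<in> blocks" by (rule U_in_blocks)
    have "i \<le> N v" using length_le_N[OF vb] length_U[OF v] less_exp[of i] by linarith
    then obtain k where k: "N v = k + i" by (metis add.commute le_add_diff_inverse)
    have "act (Jump # map Up v) [] = Some (replicate (N v) 0)"
      using act_up[of v "[]"] vb blocks_subset_tails by (auto simp: act_Cons map_comp_def)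
    then have "act (replicate k Down @ Jump # map Up v) [] = Some t"
      using act_down[of k i] unfolding k 2 by (simp add: act_append map_comp_def)
    then show ?thesis by blast
  qed
qed

lemma act_transitive:
  assumes "s \<in> vertices" "t \<in> vertices"
  shows "\<exists>\<alpha>. act \<alpha> s = Some t"
proof -
  obtain \<alpha> \<beta> where "act \<alpha> s = Some []" "act \<beta> [] = Some t"
    using act_to_root[OF assms(1)] act_from_root[OF assms(2)] by blast
  then have "act (\<beta> @ \<alpha>) s = Some t" by (simp add: act_append)
  then show ?thesis by blast
qed

lemma act_point: "act [Up 1, Down] = [[0] \<mapsto> [1]]" "[1] \<in> vertices" "[0] \<in> vertices"
proof -
  have "[1] \<in> U 0" using f_pos unfolding U_0 by auto
  then have one: "[1] \<in> tails" using U_in_blocks blocks_subset_tails by blast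
  then show "[1] \<in> vertices" unfolding vertices_def by blast
  show zero: "[0] \<in> vertices" using replicate_zero_in_vertices[of 1] by simp
  show "act [Up 1, Down] = [[0] \<mapsto> [1]]"
  proof
    fix s
    show "act [Up 1, Down] s = [[0] \<mapsto> [1]] s"
    proof (cases "\<exists>i. s = replicate (Suc i) 0")
      case True
      then obtain i where s: "s = replicate (Suc i) 0" by blast
      then have "s \<in> vertices" using replicate_zero_in_vertices by blast
      then show ?thesis using one Cons_replicate_zero_in_tails[of 1 i]
        by (cases i) (auto simp: act_Cons map_comp_def s)
    next
      case False
      then have "s \<noteq> [0]" by (metis replicate.simps)
      then show ?thesis using False by (simp add: act_Cons map_comp_def)
    qed
  qed
qed

end

section \<open>Growth with respect to a filtration by finite sets\<close>

context vectorspace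
begin

lemma card_indep_le_card_spanning:
  assumes "finite X" "X \<subseteq> carrier V" "T \<subseteq> span X" "lin_indpt T"
  shows "finite T \<and> card T \<le> card X"
proof -
  have sub: "subspace K (span X) V" using span_is_subspace assms by blast
  interpret S: vectorspace K "vs (span X)" by (rule subspace_is_vs[OF sub])
  have sm: "submodule K (span X) V" using sub by simp
  have XS: "X \<subseteq> span X" using in_own_span assms by blast
  have gen: "S.gen_set X" using span_li_not_depend(1)[OF XS sm] by simp
  have fd: "S.fin_dim" unfolding S.fin_dim_def using gen assms XS by auto
  have li: "S.lin_indpt T" using span_li_not_depend(2)[OF assms(3) sm] assms(4) by simp
  have fin: "finite T" by (rule S.li_le_dim(1)[OF fd]) (use assms(3) li in auto)
  moreover have "card T \<le> card X"
    by (rule S.li_smaller_than_gen) (use fin assms XS li gen in auto)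
  ultimately show ?thesis by blast
qed

text \<open>The subspace is not known to be finitely generated in advance; a maximal independent subset
exists because the size of independent subsets is bounded by \<open>card X\<close>.\<close>
lemma subspace_of_finite_span:
  assumes "finite X" "X \<subseteq> carrier V" "subspace K S V" "S \<subseteq> span X"
  shows "vectorspace.fin_dim K (vs S)" "vectorspace.dim K (vs S) \<le> card X"
proof -
  interpret S: vectorspace K "vs S" by (rule subspace_is_vs[OF assms(3)])
  have sm: "submodule K S V" using assms(3) by simp
  have bound: "finite T \<and> card T \<le> card X" if "T \<subseteq> S \<and> S.lin_indpt T" for T
  proof -
    have "lin_indpt T" using span_li_not_depend(2)[OF _ sm] that by blast
    then show ?thesis using card_indep_le_card_spanning[OF assms(1,2)] that assms(4) by blast
  qed
  moreover have "{} \<subseteq> S \<and> S.lin_indpt {}" unfolding S.lin_dep_def by auto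
  ultimately obtain T where T: "finite T" "maximal T (\<lambda>T. T \<subseteq> S \<and> S.lin_indpt T)"
    using maximal_exists[of "\<lambda>T. T \<subseteq> S \<and> S.lin_indpt T" "card X" "{}"] by blast
  have basis: "S.basis T" using S.max_li_is_basis[of T] T by simp
  then have gen: "S.gen_set T" "T \<subseteq> S" unfolding S.basis_def by auto
  show "S.fin_dim" unfolding S.fin_dim_def using T gen by auto
  have "S.dim = card T" by (rule S.dim_basis[OF T(1) basis])
  also have "\<dots> \<le> card X" using bound[of T] T(2) unfolding maximal_def by blast
  finally show "S.dim \<le> card X" .
qed

lemma span_subset_span:
  "X \<subseteq> span Y \<Longrightarrow> Y \<subseteq> carrier V \<Longrightarrow> span X \<subseteq> span Y"
  by (intro span_is_subset span_is_submodule)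

lemma span_subspace_eq: "subspace K S V \<Longrightarrow> span S = S"
proof
  assume S: "subspace K S V"
  then have sm: "submodule K S V" by simp
  then show "span S \<subseteq> S" by (intro span_is_subset) auto
  show "S \<subseteq> span S" using sm in_own_span unfolding LinearCombinations.submodule_def by blast
qed

end

context assoc_algebra
begin

lemma span_mult_closed:
  assumes X: "X \<subseteq> carrier A" and Y: "Y \<subseteq> carrier A" and Z: "Z \<subseteq> carrier A"
    and XY: "\<And>x y. x \<in> X \<Longrightarrow> y \<in> Y \<Longrightarrow> x \<otimes> y \<in> span Z"
    and x: "x \<in> span X" and y: "y \<in> span Y"
  shows "x \<otimes> y \<in> span Z"
proof -
  have Zs: "LinearCombinations.submodule F (span Z) A" using span_is_submodule[OF Z] .
  note Zc = LinearCombinations.submodule.m_closed[OF Zs] LinearCombinations.submodule.zero_closed[OF Zs]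
    LinearCombinations.submodule.smult_closed[OF Zs]
  have mod: "module F A" ..
  have 1: "x \<otimes> y \<in> span Z" if "x \<in> span X" "y \<in> Y" for x y
  proof -
    have yc: "y \<in> carrier A" using that Y by blast
    have "LinearCombinations.submodule F {x \<in> carrier A. x \<otimes> y \<in> span Z} A"
      by (rule LinearCombinations.submodule.intro)
         (use yc Zc mod in \<open>auto simp: alg.l_distr smult_mult_left\<close>)
    moreover have "X \<subseteq> {x \<in> carrier A. x \<otimes> y \<in> span Z}" using X XY that by blast
    ultimately show ?thesis using span_is_subset that(1) by blast
  qed
  have xc: "x \<in> carrier A" using x X by simp
  have "LinearCombinations.submodule F {y \<in> carrier A. x \<otimes> y \<in> span Z} A"
    by (rule LinearCombinations.submodule.intro)
       (use xc Zc mod in \<open>auto simp: alg.r_distr smult_mult_right\<close>)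
  moreover have "Y \<subseteq> {y \<in> carrier A. x \<otimes> y \<in> span Z}" using Y 1[OF x] by blast
  ultimately show ?thesis using span_is_subset y by blast
qed

definition powers_upto :: "'c set \<Rightarrow> nat \<Rightarrow> 'c set" where
  "powers_upto V n = span (\<Union>k\<le>n. subspace_power F A V k)"

lemma growth_eq: "growth F A V n = vectorspace.dim F (vs (powers_upto V n))"
  unfolding growth_def powers_upto_def ..

context
  fixes V assumes V: "V \<subseteq> carrier A"
begin

lemma subspace_power_closed: "subspace_power F A V k \<subseteq> carrier A"
proof (induction k)
  case 0
  then show ?case using span_is_subset2[of "{\<one>}"] by simp
next
  case (Suc k)
  then show ?case using V by (auto intro!: span_is_subset2)
qed

lemma subspace_power_Suc_intro:
  "x \<in> subspace_power F A V k \<Longrightarrow> v \<in> V \<Longrightarrow> x \<otimes> v \<in> subspace_power F A V (Suc k)"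
  using in_own_span[of "{x \<otimes> v |x v. x \<in> subspace_power F A V k \<and> v \<in> V}"] subspace_power_closed[of k] V
  by auto

lemma subspace_power_subspace: "VectorSpace.subspace F (subspace_power F A V k) A"
proof (cases k)
  case 0
  then show ?thesis using span_is_subspace[of "{\<one>}"] by simp
next
  case (Suc j)
  then show ?thesis using subspace_power_closed[of j] V by (auto intro!: span_is_subspace)
qed

lemma subspace_power_mult:
  "x \<in> subspace_power F A V i \<Longrightarrow> y \<in> subspace_power F A V j \<Longrightarrow> x \<otimes> y \<in> subspace_power F A V (i + j)"
proof (induction j arbitrary: x y)
  case 0
  have xc: "x \<in> carrier A" using 0 subspace_power_closed by blast
  have "x \<otimes> y \<in> span (subspace_power F A V i)"
    by (rule span_mult_closed[of "{x}" "{\<one>}"])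
       (use 0 xc subspace_power_closed in_own_span[OF subspace_power_closed] in \<open>auto simp: span_self\<close>)
  then show ?case using span_subspace_eq[OF subspace_power_subspace] by simp
next
  case (Suc j)
  let ?Y = "{y \<otimes> v |y v. y \<in> subspace_power F A V j \<and> v \<in> V}"
  have xc: "x \<in> carrier A" using Suc subspace_power_closed by blast
  have "x \<otimes> y \<in> span (subspace_power F A V (Suc (i + j)))"
  proof (rule span_mult_closed[of "{x}" ?Y])
    show "?Y \<subseteq> carrier A" using subspace_power_closed V by (auto simp: subset_iff)
  next
    fix x' y' assume "x' \<in> {x}" "y' \<in> ?Y"
    then obtain z v where z: "x' = x" "y' = z \<otimes> v" "z \<in> subspace_power F A V j" "v \<in> V" by blast
    have "x \<otimes> (z \<otimes> v) = (x \<otimes> z) \<otimes> v" using z xc subspace_power_closed V by (intro alg.m_assoc[symmetric]) auto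
    moreover have "(x \<otimes> z) \<otimes> v \<in> subspace_power F A V (Suc (i + j))"
      by (rule subspace_power_Suc_intro) (use Suc z in auto)
    ultimately show "x' \<otimes> y' \<in> span (subspace_power F A V (Suc (i + j)))"
      using in_own_span[OF subspace_power_closed] z by (metis subsetD)
  next
    show "{x} \<subseteq> carrier A" "x \<in> span {x}" using xc by (simp_all add: span_self)
    show "subspace_power F A V (Suc (i + j)) \<subseteq> carrier A" by (rule subspace_power_closed)
    show "y \<in> span ?Y" using Suc.prems by simp
  qed
  then show ?case unfolding span_subspace_eq[OF subspace_power_subspace] add_Suc_right .
qed

lemma Union_powers_closed: "(\<Union>k\<le>n. subspace_power F A V k) \<subseteq> carrier A"
  using subspace_power_closed by blast

lemma powers_upto_subspace: "VectorSpace.subspace F (powers_upto V n) A"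
  unfolding powers_upto_def by (rule span_is_subspace[OF Union_powers_closed])

lemma subspace_power_subset_powers_upto: "k \<le> n \<Longrightarrow> subspace_power F A V k \<subseteq> powers_upto V n"
  unfolding powers_upto_def using in_own_span[OF Union_powers_closed, of n] by auto

lemma powers_upto_mono: "m \<le> n \<Longrightarrow> powers_upto V m \<subseteq> powers_upto V n"
  unfolding powers_upto_def by (intro span_is_monotone UN_mono) auto

lemma powers_upto_mult: "x \<in> powers_upto V m \<Longrightarrow> y \<in> powers_upto V n \<Longrightarrow> x \<otimes> y \<in> powers_upto V (m + n)"
  unfolding powers_upto_def
proof (rule span_mult_closed[OF Union_powers_closed Union_powers_closed Union_powers_closed])
  fix x y assume "x \<in> (\<Union>k\<le>m. subspace_power F A V k)" "y \<in> (\<Union>k\<le>n. subspace_power F A V k)"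
  then obtain i j where "i \<le> m" "j \<le> n" "x \<in> subspace_power F A V i" "y \<in> subspace_power F A V j" by blast
  then have "x \<otimes> y \<in> subspace_power F A V (i + j)" "i + j \<le> m + n" using subspace_power_mult by auto
  then show "x \<otimes> y \<in> span (\<Union>k\<le>m + n. subspace_power F A V k)"
    using in_own_span[OF Union_powers_closed, of "m + n"] by auto
qed

lemma one_in_power_0: "\<one> \<in> subspace_power F A V 0"
  using span_self[of \<one>] by simp

lemma subset_power_1: "V \<subseteq> subspace_power F A V 1"
proof
  fix v assume "v \<in> V"
  then show "v \<in> subspace_power F A V 1"
    using subspace_power_Suc_intro[OF one_in_power_0 \<open>v \<in> V\<close>] V by auto
qed

text \<open>The union of the \<open>powers_upto V n\<close> is a unital subalgebra that contains \<open>V\<close>.\<close>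
lemma exhausts:
  assumes "generates_algebra F A V"
  shows "carrier A = (\<Union>n. powers_upto V n)"
proof -
  let ?B = "\<Union>n. powers_upto V n"
  have sm: "LinearCombinations.submodule F (powers_upto V n) A" for n
    using powers_upto_subspace by simp
  have "VectorSpace.subspace F ?B A"
  proof -
    have "LinearCombinations.submodule F ?B A"
    proof (rule nested_union_vs[of UNIV "powers_upto V"])
      show "\<exists>k. k \<in> UNIV \<and> powers_upto V i \<subseteq> powers_upto V k \<and> powers_upto V j \<subseteq> powers_upto V k" for i j
        by (intro exI[of _ "max i j"] conjI powers_upto_mono) auto
    qed (use sm in auto)
    then show ?thesis unfolding VectorSpace.subspace_def using vectorspace_axioms by simp
  qed
  moreover have "\<one> \<in> ?B" using one_in_power_0 subspace_power_subset_powers_upto[of 0 0] by blast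
  moreover have "\<forall>x\<in>?B. \<forall>y\<in>?B. x \<otimes> y \<in> ?B" using powers_upto_mult by blast
  moreover have "V \<subseteq> ?B" using subset_power_1 subspace_power_subset_powers_upto[of 1 1] by blast
  ultimately show ?thesis using assms unfolding generates_algebra_def unital_subalgebra_def by blast
qed

end

end

lemma finite_subset_of_chain:
  assumes "finite X" "X \<subseteq> (\<Union>n. U n)" "\<And>m n. m \<le> n \<Longrightarrow> U m \<subseteq> U n"
  shows "\<exists>n::nat. n \<ge> 1 \<and> X \<subseteq> U n"
  using assms(1,2)
proof (induction X)
  case empty then show ?case by auto
next
  case (insert x X)
  then obtain m n where "n \<ge> 1" "X \<subseteq> U n" "x \<in> U m" by auto
  then show ?case using assms(3)[of m "max m n"] assms(3)[of n "max m n"]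
    by (intro exI[of _ "max m n"]) auto
qed

text \<open>The set \<open>W n\<close> stands for the values of the words of length at most \<open>n\<close> in a finite set of generators. These sets
compare with the powers of any generating subspace, up to a constant factor in the length.\<close>
locale word_filtration = assoc_algebra F A
  for F :: "('f, 'e) ring_scheme" and A :: "('f, 'a, 'm) module_scheme" (structure) +
  fixes W :: "nat \<Rightarrow> 'a set"
  assumes W_finite: "finite (W n)" and W_closed: "W n \<subseteq> carrier A"
    and W_mono: "m \<le> n \<Longrightarrow> W m \<subseteq> W n"
    and one_in_W: "\<one> \<in> W 0"
    and W_mult: "x \<in> W m \<Longrightarrow> y \<in> W n \<Longrightarrow> x \<otimes> y \<in> W (m + n)"
    and W_Suc: "W (Suc n) \<subseteq> W n \<union> {g \<otimes> w | g w. g \<in> W 1 \<and> w \<in> W n}"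
    and W_0: "W 0 \<subseteq> {\<one>}"
    and W_spans: "carrier A \<subseteq> span (\<Union>n. W n)"
begin

lemma carrier_eq_Union_span: "carrier A = (\<Union>n. span (W n))"
proof
  show "carrier A \<subseteq> (\<Union>n. span (W n))"
  proof
    fix x assume "x \<in> carrier A"
    then have "x \<in> span (\<Union>n. W n)" using W_spans by blast
    then obtain a T where T: "x = lincomb a T" "finite T" "T \<subseteq> (\<Union>n. W n)" "a \<in> T \<rightarrow> carrier F"
      unfolding span_def mem_Collect_eq by (elim exE conjE)
    obtain n where "T \<subseteq> W n" using finite_subset_of_chain[OF T(2,3) W_mono] by blast
    then have "x \<in> span (W n)" unfolding span_def mem_Collect_eq using T(1,2,4) by (intro exI conjI)
    then show "x \<in> (\<Union>n. span (W n))" by blast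
  qed
  show "(\<Union>n. span (W n)) \<subseteq> carrier A" using span_is_subset2[OF W_closed] by blast
qed

lemma span_W_mono: "m \<le> n \<Longrightarrow> span (W m) \<subseteq> span (W n)"
  by (intro span_is_monotone W_mono)

lemma W_1_generates: "generates_algebra F A (W 1)"
  unfolding generates_algebra_def
proof (intro conjI allI impI)
  show "W 1 \<subseteq> carrier A" by (rule W_closed)
  fix B assume B: "unital_subalgebra F B A \<and> W 1 \<subseteq> B"
  then have sub: "VectorSpace.subspace F B A" and mult: "\<And>x y. x \<in> B \<Longrightarrow> y \<in> B \<Longrightarrow> x \<otimes> y \<in> B"
    and one: "\<one> \<in> B" unfolding unital_subalgebra_def by auto
  have sm: "LinearCombinations.submodule F B A" using sub by simp
  have "W n \<subseteq> B" for n
  proof (induction n)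
    case 0 then show ?case using W_0 one by blast
  next
    case (Suc n) then show ?case using W_Suc[of n] mult B by blast
  qed
  then have "span (W n) \<subseteq> B" for n using span_is_subset[OF _ sm] by blast
  then have "carrier A \<subseteq> B" unfolding carrier_eq_Union_span by blast
  moreover have "B \<subseteq> carrier A" by (rule LinearCombinations.submodule.subset[OF sm])
  ultimately show "B = carrier A" by blast
qed

lemma finitely_generated: "finitely_generated_algebra F A"
  unfolding finitely_generated_algebra_def using assoc_algebra_axioms W_finite W_1_generates by blast

lemma generating_subspace_in_span_W:
  assumes "generating_subspace F A V"
  shows "\<exists>c\<ge>1. V \<subseteq> span (W c)"
proof -
  have sub: "VectorSpace.subspace F V A" and fd: "vectorspace.fin_dim F (vs V)"
    using assms unfolding generating_subspace_def by auto
  interpret S: vectorspace F "vs V" by (rule subspace_is_vs[OF sub])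
  have sm: "LinearCombinations.submodule F V A" using sub by simp
  obtain X where X: "finite X" "X \<subseteq> V" "S.gen_set X" using fd unfolding S.fin_dim_def by auto
  have "X \<subseteq> carrier A" using X(2) LinearCombinations.submodule.subset[OF sm] by (rule subset_trans)
  then have "X \<subseteq> (\<Union>n. span (W n))" unfolding carrier_eq_Union_span .
  then obtain c where c: "c \<ge> 1" "X \<subseteq> span (W c)"
    using finite_subset_of_chain[of X "\<lambda>n. span (W n)", OF X(1) _ span_W_mono] by blast
  have "V = span X" using X(3) span_li_not_depend(1)[OF X(2) sm] by simp
  also have "\<dots> \<subseteq> span (W c)" by (rule span_subset_span[OF c(2) W_closed])
  finally show ?thesis using c by blast
qed

lemma powers_upto_subset_span_W:
  assumes "V \<subseteq> span (W c)"
  shows "powers_upto V n \<subseteq> span (W (c * n))"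
proof -
  have Vc: "V \<subseteq> carrier A" using assms span_is_subset2[OF W_closed] by blast
  have "subspace_power F A V k \<subseteq> span (W (c * k))" for k
  proof (induction k)
    case 0
    have "span {\<one>} \<subseteq> span (W 0)" using one_in_W by (intro span_is_monotone) auto
    then show ?case by simp
  next
    case (Suc k)
    have "{x \<otimes> v |x v. x \<in> subspace_power F A V k \<and> v \<in> V} \<subseteq> span (W (c * Suc k))"
    proof clarify
      fix x v assume "x \<in> subspace_power F A V k" "v \<in> V"
      then have xv: "x \<in> span (W (c * k))" "v \<in> span (W c)" using Suc assms by auto
      show "x \<otimes> v \<in> span (W (c * Suc k))"
      proof (rule span_mult_closed[OF W_closed W_closed W_closed _ xv])
        fix x y assume "x \<in> W (c * k)" "y \<in> W c"
        then have "x \<otimes> y \<in> W (c * k + c)" by (rule W_mult)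
        then show "x \<otimes> y \<in> span (W (c * Suc k))"
          using in_own_span[OF W_closed] by (auto simp: add.commute)
      qed
    qed
    then show ?case using span_subset_span[OF _ W_closed] by simp
  qed
  moreover have "span (W (c * k)) \<subseteq> span (W (c * n))" if "k \<le> n" for k
    using that by (intro span_W_mono) simp
  ultimately have "(\<Union>k\<le>n. subspace_power F A V k) \<subseteq> span (W (c * n))" by blast
  then show ?thesis unfolding powers_upto_def by (rule span_subset_span[OF _ W_closed])
qed

lemma growth_le:
  assumes "V \<subseteq> span (W c)"
  shows "growth F A V n \<le> card (W (c * n))"
proof -
  have Vc: "V \<subseteq> carrier A" using assms span_is_subset2[OF W_closed] by blast
  show ?thesis unfolding growth_eq
    by (rule subspace_of_finite_span(2)[OF W_finite W_closed powers_upto_subspace[OF Vc]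
          powers_upto_subset_span_W[OF assms]])
qed

lemma W_subset_powers_upto:
  assumes "generating_subspace F A V"
  shows "\<exists>c\<ge>1. \<forall>n. W n \<subseteq> powers_upto V (c * n)"
proof -
  have gen: "generates_algebra F A V" using assms unfolding generating_subspace_def by blast
  then have Vc: "V \<subseteq> carrier A" unfolding generates_algebra_def by blast
  obtain c where c: "c \<ge> 1" "W 1 \<subseteq> powers_upto V c"
  proof -
    have "W 1 \<subseteq> (\<Union>n. powers_upto V n)" using W_closed[of 1] unfolding exhausts[OF Vc gen] .
    from finite_subset_of_chain[of _ "powers_upto V", OF W_finite this powers_upto_mono[OF Vc]] that
    show thesis by blast
  qed
  have "W n \<subseteq> powers_upto V (c * n)" for n
  proof (induction n)
    case 0
    then show ?case
      using W_0 one_in_power_0[OF Vc] subspace_power_subset_powers_upto[OF Vc, of 0 0] by auto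
  next
    case (Suc n)
    have "powers_upto V (c * n) \<subseteq> powers_upto V (c * Suc n)" by (rule powers_upto_mono[OF Vc]) simp
    moreover have "g \<otimes> w \<in> powers_upto V (c * Suc n)" if "g \<in> W 1" "w \<in> W n" for g w
      using powers_upto_mult[OF Vc, of g c w "c * n"] that c Suc by auto
    ultimately show ?case using Suc W_Suc[of n] by blast
  qed
  then show ?thesis using c by blast
qed

text \<open>The hypothesis on \<open>V\<close> ensures that \<open>powers_upto V n\<close> has finite dimension, so that its dimension bounds the size of
independent sets.\<close>
lemma card_indep_le_growth:
  assumes "generating_subspace F A V" "T \<subseteq> powers_upto V n" "lin_indpt T"
  shows "card T \<le> growth F A V n"
proof -
  have Vc: "V \<subseteq> carrier A"
    using assms unfolding generating_subspace_def generates_algebra_def by blast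
  obtain c where c: "V \<subseteq> span (W c)" using generating_subspace_in_span_W[OF assms(1)] by blast
  let ?S = "powers_upto V n"
  have sub: "VectorSpace.subspace F ?S A" by (rule powers_upto_subspace[OF Vc])
  interpret S: vectorspace F "vs ?S" by (rule subspace_is_vs[OF sub])
  have sm: "LinearCombinations.submodule F ?S A" using sub by simp
  have fd: "S.fin_dim"
    by (rule subspace_of_finite_span(1)[OF W_finite W_closed sub powers_upto_subset_span_W[OF c]])
  have "S.lin_indpt T" using span_li_not_depend(2)[OF assms(2) sm] assms(3) by blast
  then have "card T \<le> S.dim" using S.li_le_dim(2)[OF fd] assms(2) by simp
  then show ?thesis unfolding growth_eq .
qed

end

section \<open>A criterion for primitivity\<close>

text \<open>The irreducible module is the left ideal \<open>R g\<close>. By \<open>recover\<close> every nonzero element of \<open>R g\<close>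
generates it. Its elements are wrapped into singletons, so
that the module lives on the type of sets of ring elements.\<close>
lemma (in ring) primitive_ringI:
  assumes g: "g \<in> carrier R" "g \<noteq> \<zero>"
    and recover: "\<And>a. a \<in> carrier R \<Longrightarrow> a \<otimes> g \<noteq> \<zero> \<Longrightarrow> \<exists>b\<in>carrier R. b \<otimes> (a \<otimes> g) = g"
    and faithful: "\<And>a. a \<in> carrier R \<Longrightarrow> (\<And>x. x \<in> carrier R \<Longrightarrow> a \<otimes> (x \<otimes> g) = \<zero>) \<Longrightarrow> a = \<zero>"
  shows "primitive_ring R"
proof -
  define L where "L = {a \<otimes> g |a. a \<in> carrier R}"
  define M :: "('a, 'a set) module" where
    "M = \<lparr>carrier = (\<lambda>x. {x}) ` L, monoid.mult = (\<lambda>X Y. X), one = {\<zero>}, zero = {\<zero>},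
          add = (\<lambda>X Y. {the_elem X \<oplus> the_elem Y}), smult = (\<lambda>a X. {a \<otimes> the_elem X})\<rparr>"
  have L_carrier: "x \<in> carrier R" if "x \<in> L" for x using that g unfolding L_def by auto
  have L_zero: "\<zero> \<in> L" unfolding L_def using g by (auto intro!: exI[of _ \<zero>])
  have L_add: "x \<oplus> y \<in> L" if xy: "x \<in> L" "y \<in> L" for x y
  proof -
    obtain a b where "a \<in> carrier R" "b \<in> carrier R" "x = a \<otimes> g" "y = b \<otimes> g"
      using xy unfolding L_def by blast
    then show ?thesis unfolding L_def using g by (auto intro!: exI[of _ "a \<oplus> b"] simp: l_distr)
  qed
  have L_mult: "a \<otimes> x \<in> L" if ax: "a \<in> carrier R" "x \<in> L" for a x
  proof -
    obtain b where "b \<in> carrier R" "x = b \<otimes> g" using ax unfolding L_def by blast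
    then show ?thesis unfolding L_def using g ax by (auto intro!: exI[of _ "a \<otimes> b"] simp: m_assoc)
  qed
  have g_L: "g \<in> L" unfolding L_def using g by (auto intro!: exI[of _ \<one>])
  have neg: "\<exists>y\<in>L. y \<oplus> x = \<zero>" if "x \<in> L" for x
    using L_mult[of "\<ominus> \<one>" x] that L_carrier[OF that]
    by (intro bexI[of _ "\<ominus> \<one> \<otimes> x"]) (simp_all add: l_minus l_neg)
  have M_group: "abelian_group M"
  proof (rule abelian_groupI)
    fix X assume "X \<in> carrier M"
    then obtain x where "X = {x}" "x \<in> L" unfolding M_def by auto
    moreover obtain y where "y \<in> L" "y \<oplus> x = \<zero>" using neg \<open>x \<in> L\<close> by blast
    ultimately show "\<exists>Y\<in>carrier M. Y \<oplus>\<^bsub>M\<^esub> X = \<zero>\<^bsub>M\<^esub>"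
      unfolding M_def by (intro bexI[of _ "{y}"]) auto
  qed (auto simp: M_def L_zero L_add L_carrier a_assoc a_comm a_lcomm)
  have M_mod: "left_module R M"
    by (intro left_module.intro left_module_axioms.intro ring_axioms M_group)
       (auto simp: M_def L_mult L_carrier l_distr r_distr m_assoc)
  have "irreducible_module R M"
    unfolding irreducible_module_def
  proof (intro conjI allI impI M_mod)
    show "carrier M \<noteq> {\<zero>\<^bsub>M\<^esub>}" using g g_L unfolding M_def by auto
    fix P assume P: "Module.submodule P R M"
    show "P = {\<zero>\<^bsub>M\<^esub>} \<or> P = carrier M"
    proof (cases "P \<subseteq> {\<zero>\<^bsub>M\<^esub>}")
      case True
      moreover have "\<zero>\<^bsub>M\<^esub> \<in> P"
        using subgroup.one_closed[OF Module.submodule.axioms(1)[OF P]] by simp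
      ultimately show ?thesis by blast
    next
      case False
      have PM: "P \<subseteq> carrier M" using subgroup.subset[OF Module.submodule.axioms(1)[OF P]] by simp
      have smult: "a \<odot>\<^bsub>M\<^esub> X \<in> P" if "a \<in> carrier R" "X \<in> P" for a X
        using Module.submodule.smult_closed[OF P that] .
      obtain X where "X \<in> P" "X \<noteq> \<zero>\<^bsub>M\<^esub>" using False by blast
      obtain a where a: "X = {a \<otimes> g}" "a \<in> carrier R"
        using \<open>X \<in> P\<close> PM unfolding M_def L_def by auto
      have "a \<otimes> g \<noteq> \<zero>" using \<open>X \<noteq> \<zero>\<^bsub>M\<^esub>\<close> a(1) unfolding M_def by simp
      obtain b where "b \<in> carrier R" "b \<otimes> (a \<otimes> g) = g"
        using recover[OF a(2) \<open>a \<otimes> g \<noteq> \<zero>\<close>] by blast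
      then have gP: "{g} \<in> P" using smult[OF _ \<open>X \<in> P\<close>, of b] a(1) unfolding M_def by simp
      have "carrier M \<subseteq> P"
      proof
        fix Y assume "Y \<in> carrier M"
        then obtain c where "c \<in> carrier R" "Y = {c \<otimes> g}" unfolding M_def L_def by auto
        then show "Y \<in> P" using smult[OF _ gP, of c] unfolding M_def by simp
      qed
      then show ?thesis using PM by blast
    qed
  qed
  moreover have "faithful_module R M"
    unfolding faithful_module_def
  proof (intro ballI impI)
    fix a assume a: "a \<in> carrier R" "\<forall>X\<in>carrier M. a \<odot>\<^bsub>M\<^esub> X = \<zero>\<^bsub>M\<^esub>"
    show "a = \<zero>"
    proof (rule faithful[OF a(1)])
      fix x assume "x \<in> carrier R"
      then have "{x \<otimes> g} \<in> carrier M" unfolding M_def L_def by auto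
      then show "a \<otimes> (x \<otimes> g) = \<zero>" using a(2) unfolding M_def by fastforce
    qed
  qed
  ultimately show ?thesis unfolding primitive_ring_def by blast
qed

lemma (in assoc_algebra) subalgebra_assoc_algebra:
  assumes S: "unital_subalgebra F S A"
  shows "assoc_algebra F (vs S)"
proof -
  have sub: "VectorSpace.subspace F S A" and one: "\<one> \<in> S"
    and mult: "\<And>x y. x \<in> S \<Longrightarrow> y \<in> S \<Longrightarrow> x \<otimes> y \<in> S"
    using S unfolding unital_subalgebra_def by auto
  have sc: "x \<in> carrier A" if "x \<in> S" for x
    using that sub LinearCombinations.submodule.subset is_module by blast
  interpret S: vectorspace F "vs S" by (rule subspace_is_vs[OF sub])
  have "ring (vs S)"
  proof (rule ringI)
    show "abelian_group (vs S)" by (rule S.abelian_group_axioms)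
    show "monoid (vs S)" by (rule monoidI) (auto simp: one mult sc alg.m_assoc)
  qed (auto simp: sc alg.l_distr alg.r_distr)
  moreover have "assoc_algebra_axioms F (vs S)"
    by unfold_locales (auto simp: sc smult_mult_left smult_mult_right)
  ultimately show ?thesis unfolding assoc_algebra_def using S.vectorspace_axioms by blast
qed

section \<open>Row-finite matrices\<close>

text \<open>Matrices indexed by words are stored as functions on words: the word of length two that consists of the codes of
\<open>t\<close> and \<open>s\<close> holds the entry in row \<open>t\<close> and column \<open>s\<close>.\<close>
definition key :: "nat list \<Rightarrow> nat list \<Rightarrow> nat list" where
  "key t s = [list_encode t, list_encode s]"

definition entry :: "(nat list \<Rightarrow> 'f) \<Rightarrow> nat list \<Rightarrow> nat list \<Rightarrow> 'f" where
  "entry a t s = a (key t s)"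

definition of_entries :: "'f \<Rightarrow> (nat list \<Rightarrow> nat list \<Rightarrow> 'f) \<Rightarrow> nat list \<Rightarrow> 'f" where
  "of_entries z m l = (case l of [i, j] \<Rightarrow> m (list_decode i) (list_decode j) | _ \<Rightarrow> z)"

lemma entry_of_entries [simp]: "entry (of_entries z m) t s = m t s"
  by (simp add: entry_def of_entries_def key_def)

lemma of_entries_not_key: "l \<notin> range (\<lambda>(t, s). key t s) \<Longrightarrow> of_entries z m l = z"
proof -
  assume l: "l \<notin> range (\<lambda>(t, s). key t s)"
  have "l \<noteq> [i, j]" for i j
    using l rangeI[of "\<lambda>(t, s). key t s" "(list_decode i, list_decode j)"] by (auto simp: key_def)
  then show ?thesis unfolding of_entries_def by (auto split: list.splits)
qed

locale matrix_algebra = field F for F :: "('f, 'e) ring_scheme" (structure) +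
  fixes B :: "nat list set"
begin

definition support :: "(nat list \<Rightarrow> 'f) \<Rightarrow> nat list \<Rightarrow> nat list set" where
  "support a t = {s. entry a t s \<noteq> \<zero>}"

text \<open>All rows are finite, which makes the product well defined. Functions vanish on words that are not keys, so
that they are determined by their entries.\<close>
definition matrices :: "(nat list \<Rightarrow> 'f) set" where
  "matrices = {a. range a \<subseteq> carrier F \<and> (\<forall>l. l \<notin> range (\<lambda>(t, s). key t s) \<longrightarrow> a l = \<zero>) \<and>
     (\<forall>t. finite (support a t)) \<and> (\<forall>t s. entry a t s \<noteq> \<zero> \<longrightarrow> t \<in> B \<and> s \<in> B)}"

definition mat_mult :: "(nat list \<Rightarrow> 'f) \<Rightarrow> (nat list \<Rightarrow> 'f) \<Rightarrow> nat list \<Rightarrow> 'f" where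
  "mat_mult a b = of_entries \<zero> (\<lambda>t s. \<Oplus>r\<in>support a t. entry a t r \<otimes> entry b r s)"

definition matrix_ring :: "('f, nat list \<Rightarrow> 'f) module" where
  "matrix_ring = \<lparr>carrier = matrices, monoid.mult = mat_mult,
     one = of_entries \<zero> (\<lambda>t s. if t = s \<and> t \<in> B then \<one> else \<zero>),
     zero = (\<lambda>l. \<zero>), add = (\<lambda>a b l. a l \<oplus> b l), smult = (\<lambda>c a l. c \<otimes> a l)\<rparr>"

lemma matrix_ring_simps: "carrier matrix_ring = matrices" "monoid.mult matrix_ring = mat_mult" "\<zero>\<^bsub>matrix_ring\<^esub> = (\<lambda>l. \<zero>)"
  "one matrix_ring = of_entries \<zero> (\<lambda>t s. if t = s \<and> t \<in> B then \<one> else \<zero>)"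
  "add matrix_ring = (\<lambda>a b l. a l \<oplus> b l)" "smult matrix_ring = (\<lambda>c a l. c \<otimes> a l)"
  by (simp_all add: matrix_ring_def)

lemma entry_closed [simp]: "a \<in> matrices \<Longrightarrow> entry a t s \<in> carrier F"
  unfolding matrices_def entry_def by auto

lemma closed: "a \<in> matrices \<Longrightarrow> a l \<in> carrier F"
  unfolding matrices_def by auto

lemma support_finite [simp]: "a \<in> matrices \<Longrightarrow> finite (support a t)"
  unfolding matrices_def by auto

lemma entry_in_B: "a \<in> matrices \<Longrightarrow> entry a t s \<noteq> \<zero> \<Longrightarrow> t \<in> B \<and> s \<in> B"
  unfolding matrices_def by auto

lemma entry_zero [simp]: "entry (\<lambda>l. \<zero>) t s = \<zero>" by (simp add: entry_def)
lemma entry_add [simp]: "entry (\<lambda>l. a l \<oplus> b l) t s = entry a t s \<oplus> entry b t s" by (simp add: entry_def)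
lemma entry_smult [simp]: "entry (\<lambda>l. c \<otimes> a l) t s = c \<otimes> entry a t s" by (simp add: entry_def)

lemma matrix_eqI:
  assumes "a \<in> matrices" "b \<in> matrices" "\<And>t s. entry a t s = entry b t s"
  shows "a = b"
proof
  fix l
  show "a l = b l"
  proof (cases "l \<in> range (\<lambda>(t, s). key t s)")
    case True
    then obtain t s where "l = key t s" by auto
    then show ?thesis using assms(3)[of t s] by (simp add: entry_def)
  next
    case False
    then show ?thesis using assms(1,2) unfolding matrices_def by simp
  qed
qed

lemma of_entries_in_matrices:
  assumes "\<And>t s. m t s \<in> carrier F" "\<And>t. finite {s. m t s \<noteq> \<zero>}"
    "\<And>t s. m t s \<noteq> \<zero> \<Longrightarrow> t \<in> B \<and> s \<in> B"
  shows "of_entries \<zero> m \<in> matrices"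
proof -
  have "of_entries \<zero> m l \<in> carrier F" for l
    unfolding of_entries_def using assms(1) by (auto split: list.splits)
  then show ?thesis unfolding matrices_def support_def
    using assms(2,3) of_entries_not_key[of _ \<zero> m] by (simp add: image_subset_iff)
qed

lemma matricesI:
  assumes "\<And>l. a l \<in> carrier F" "\<And>l. l \<notin> range (\<lambda>(t, s). key t s) \<Longrightarrow> a l = \<zero>"
    "\<And>t. finite (support a t)" "\<And>t s. entry a t s \<noteq> \<zero> \<Longrightarrow> t \<in> B \<and> s \<in> B"
  shows "a \<in> matrices"
  using assms unfolding matrices_def by blast

lemma not_key: "a \<in> matrices \<Longrightarrow> l \<notin> range (\<lambda>(t, s). key t s) \<Longrightarrow> a l = \<zero>"
  unfolding matrices_def by blast

lemma zero_in_matrices: "(\<lambda>l. \<zero>) \<in> matrices"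
  unfolding matrices_def support_def by auto

lemma add_in_matrices: "a \<in> matrices \<Longrightarrow> b \<in> matrices \<Longrightarrow> (\<lambda>l. a l \<oplus> b l) \<in> matrices"
proof -
  assume ab: "a \<in> matrices" "b \<in> matrices"
  have "support (\<lambda>l. a l \<oplus> b l) t \<subseteq> support a t \<union> support b t" for t
    unfolding support_def by auto
  then have "finite (support (\<lambda>l. a l \<oplus> b l) t)" for t
    using ab by (meson finite_UnI finite_subset support_finite)
  moreover have "t \<in> B \<and> s \<in> B" if "entry (\<lambda>l. a l \<oplus> b l) t s \<noteq> \<zero>" for t s
    using that entry_in_B[OF ab(1), of t s] entry_in_B[OF ab(2), of t s] by fastforce
  ultimately show ?thesis using ab by (intro matricesI) (simp_all add: closed not_key)
qed

lemma smult_in_matrices: "c \<in> carrier F \<Longrightarrow> a \<in> matrices \<Longrightarrow> (\<lambda>l. c \<otimes> a l) \<in> matrices"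
proof -
  assume ca: "c \<in> carrier F" "a \<in> matrices"
  have "support (\<lambda>l. c \<otimes> a l) t \<subseteq> support a t" for t
    unfolding support_def using ca by auto
  then have "finite (support (\<lambda>l. c \<otimes> a l) t)" for t
    using ca by (meson finite_subset support_finite)
  moreover have "t \<in> B \<and> s \<in> B" if "entry (\<lambda>l. c \<otimes> a l) t s \<noteq> \<zero>" for t s
    using that entry_in_B[OF ca(2), of t s] ca by fastforce
  ultimately show ?thesis using ca by (intro matricesI) (simp_all add: closed not_key)
qed

text \<open>Any finite set of indices that contains the support of the row may replace it; this allows a common index set for
several products in the proofs of the ring axioms.\<close>
lemma entry_mult:
  assumes "a \<in> matrices" "b \<in> matrices" "finite R" "support a t \<subseteq> R"
  shows "entry (mat_mult a b) t s = (\<Oplus>r\<in>R. entry a t r \<otimes> entry b r s)"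
  unfolding mat_mult_def entry_of_entries
  by (rule add.finprod_mono_neutral_cong_left) (use assms in \<open>auto simp: support_def\<close>)

lemma mult_in_matrices:
  assumes "a \<in> matrices" "b \<in> matrices"
  shows "mat_mult a b \<in> matrices"
  unfolding mat_mult_def
proof (rule of_entries_in_matrices)
  fix t s
  let ?m = "\<lambda>s. \<Oplus>r\<in>support a t. entry a t r \<otimes> entry b r s"
  show "?m s \<in> carrier F" using assms by (intro finsum_closed) auto
  have nonzero: "\<exists>r\<in>support a t. s \<in> support b r" if "?m s \<noteq> \<zero>" for s
  proof (rule ccontr)
    assume none: "\<not> (\<exists>r\<in>support a t. s \<in> support b r)"
    have "?m s = \<zero>"
      by (rule add.finprod_one_eqI) (use none assms in \<open>auto simp: support_def\<close>)
    then show False using that by simp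
  qed
  then have "{s. ?m s \<noteq> \<zero>} \<subseteq> (\<Union>r\<in>support a t. support b r)" by blast
  then show "finite {s. ?m s \<noteq> \<zero>}" using assms by (meson finite_UN_I finite_subset support_finite)
  assume "?m s \<noteq> \<zero>"
  then obtain r where "entry a t r \<noteq> \<zero>" "entry b r s \<noteq> \<zero>" using nonzero unfolding support_def by blast
  then show "t \<in> B \<and> s \<in> B" using entry_in_B assms by blast
qed

lemma one_in_matrices: "of_entries \<zero> (\<lambda>t s. if t = s \<and> t \<in> B then \<one> else \<zero>) \<in> matrices"
  by (rule of_entries_in_matrices) (auto split: if_splits)

lemma mult_assoc:
  assumes abc: "a \<in> matrices" "b \<in> matrices" "c \<in> matrices"
  shows "mat_mult (mat_mult a b) c = mat_mult a (mat_mult b c)"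
proof (rule matrix_eqI)
  fix t s
  let ?R = "support a t"
  let ?Q = "(\<Union>r\<in>?R. support b r) \<union> support (mat_mult a b) t"
  have finR: "finite ?R" and finQ: "finite ?Q" using abc mult_in_matrices by auto
  have "entry (mat_mult (mat_mult a b) c) t s
      = (\<Oplus>q\<in>?Q. entry (mat_mult a b) t q \<otimes> entry c q s)"
    by (rule entry_mult) (use abc mult_in_matrices finQ in auto)
  also have "\<dots> = (\<Oplus>q\<in>?Q. \<Oplus>r\<in>?R. entry a t r \<otimes> entry b r q \<otimes> entry c q s)"
  proof (rule finsum_cong')
    fix q
    have "entry (mat_mult a b) t q = (\<Oplus>r\<in>?R. entry a t r \<otimes> entry b r q)"
      by (rule entry_mult) (use abc finR in auto)
    then show "entry (mat_mult a b) t q \<otimes> entry c q s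
        = (\<Oplus>r\<in>?R. entry a t r \<otimes> entry b r q \<otimes> entry c q s)"
      using abc by (simp add: finsum_ldistr Pi_def)
  qed (use abc in \<open>auto intro!: finsum_closed\<close>)
  also have "\<dots> = (\<Oplus>r\<in>?R. \<Oplus>q\<in>?Q. entry a t r \<otimes> entry b r q \<otimes> entry c q s)"
    by (rule finsum_finsum_swap) (use abc finR finQ in auto)
  also have "\<dots> = (\<Oplus>r\<in>?R. entry a t r \<otimes> entry (mat_mult b c) r s)"
  proof (rule finsum_cong')
    fix r assume "r \<in> ?R"
    then have "entry (mat_mult b c) r s = (\<Oplus>q\<in>?Q. entry b r q \<otimes> entry c q s)"
      by (intro entry_mult) (use abc finQ in auto)
    then show "(\<Oplus>q\<in>?Q. entry a t r \<otimes> entry b r q \<otimes> entry c q s) = entry a t r \<otimes> entry (mat_mult b c) r s"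
      using abc finQ by (simp add: finsum_rdistr Pi_def m_assoc)
  qed (use abc mult_in_matrices in auto)
  also have "\<dots> = entry (mat_mult a (mat_mult b c)) t s"
    by (rule entry_mult[symmetric]) (use abc mult_in_matrices finR in auto)
  finally show "entry (mat_mult (mat_mult a b) c) t s = entry (mat_mult a (mat_mult b c)) t s" .
qed (use abc mult_in_matrices in auto)

lemma one_mult:
  assumes "a \<in> matrices"
  shows "mat_mult (of_entries \<zero> (\<lambda>t s. if t = s \<and> t \<in> B then \<one> else \<zero>)) a = a"
proof (rule matrix_eqI)
  fix t s
  have "entry (mat_mult (of_entries \<zero> (\<lambda>t s. if t = s \<and> t \<in> B then \<one> else \<zero>)) a) t s
     = (\<Oplus>r\<in>{t}. (if t = r \<and> t \<in> B then \<one> else \<zero>) \<otimes> entry a r s)"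
    by (subst entry_mult[where R = "{t}"]) (use assms one_in_matrices in \<open>auto simp: support_def\<close>)
  then show "entry (mat_mult (of_entries \<zero> (\<lambda>t s. if t = s \<and> t \<in> B then \<one> else \<zero>)) a) t s = entry a t s"
    using assms entry_in_B[OF assms, of t s] by (cases "entry a t s = \<zero>") auto
qed (use assms mult_in_matrices one_in_matrices in auto)

text \<open>The operator that maps the basis vector \<open>s\<close> to \<open>t\<close> if \<open>p s = Some t\<close>, and to zero if \<open>p\<close> is undefined at \<open>s\<close>.
Injectivity of \<open>p\<close> makes its rows finite.\<close>
definition inj_matrix :: "(nat list \<Rightarrow> nat list option) \<Rightarrow> nat list \<Rightarrow> 'f" where
  "inj_matrix p = of_entries \<zero> (\<lambda>t s. if p s = Some t then \<one> else \<zero>)"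

definition partial_injection :: "(nat list \<Rightarrow> nat list option) \<Rightarrow> bool" where
  "partial_injection p \<longleftrightarrow> (\<forall>s t. p s = Some t \<longrightarrow> s \<in> B \<and> t \<in> B) \<and>
     (\<forall>s s' t. p s = Some t \<longrightarrow> p s' = Some t \<longrightarrow> s = s')"

lemma entry_inj_matrix [simp]: "entry (inj_matrix p) t s = (if p s = Some t then \<one> else \<zero>)"
  unfolding inj_matrix_def by simp

lemma inj_matrix_in_matrices:
  assumes "partial_injection p"
  shows "inj_matrix p \<in> matrices"
  unfolding inj_matrix_def
proof (rule of_entries_in_matrices)
  fix t
  have "{s. (if p s = Some t then \<one> else \<zero>) \<noteq> \<zero>} \<subseteq> {THE s. p s = Some t}"
  proof
    fix s assume "s \<in> {s. (if p s = Some t then \<one> else \<zero>) \<noteq> \<zero>}"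
    then have "p s = Some t" by (auto split: if_splits)
    then have "(THE s. p s = Some t) = s"
      using assms unfolding partial_injection_def by (intro the_equality) blast+
    then show "s \<in> {THE s. p s = Some t}" by simp
  qed
  then show "finite {s. (if p s = Some t then \<one> else \<zero>) \<noteq> \<zero>}" by (rule finite_subset) simp
qed (use assms in \<open>auto simp: partial_injection_def split: if_splits\<close>)

lemma entry_mult_inj_matrix:
  assumes "a \<in> matrices" "partial_injection p"
  shows "entry (mat_mult a (inj_matrix p)) t s = (case p s of None \<Rightarrow> \<zero> | Some r \<Rightarrow> entry a t r)"
proof (cases "p s")
  case None
  have "entry (mat_mult a (inj_matrix p)) t s = (\<Oplus>r\<in>support a t. entry a t r \<otimes> entry (inj_matrix p) r s)"
    by (rule entry_mult) (use assms inj_matrix_in_matrices in auto)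
  also have "\<dots> = \<zero>" by (rule add.finprod_one_eqI) (use None assms in auto)
  finally show ?thesis using None by simp
next
  case (Some q)
  have "entry (mat_mult a (inj_matrix p)) t s = (\<Oplus>r\<in>insert q (support a t). entry a t r \<otimes> entry (inj_matrix p) r s)"
    by (rule entry_mult) (use assms inj_matrix_in_matrices in auto)
  also have "\<dots> = (\<Oplus>r\<in>insert q (support a t). if q = r then entry a t r else \<zero>)"
    by (rule finsum_cong') (use Some assms in auto)
  also have "\<dots> = entry a t q"
    by (rule finsum_singleton) (use assms in auto)
  finally show ?thesis using Some by simp
qed

lemma entry_inj_matrix_mult:
  assumes "a \<in> matrices" "partial_injection p" "p r = Some t"
  shows "entry (mat_mult (inj_matrix p) a) t s = entry a r s"
proof -
  have "support (inj_matrix p) t \<subseteq> {r}"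
    using assms(2,3) unfolding support_def partial_injection_def by (auto split: if_splits)
  then have "entry (mat_mult (inj_matrix p) a) t s = (\<Oplus>q\<in>{r}. entry (inj_matrix p) t q \<otimes> entry a q s)"
    by (intro entry_mult) (use assms inj_matrix_in_matrices in auto)
  then show ?thesis using assms by auto
qed

lemma entry_inj_matrix_mult_zero:
  assumes "a \<in> matrices" "partial_injection p" "\<And>r. p r \<noteq> Some t"
  shows "entry (mat_mult (inj_matrix p) a) t s = \<zero>"
proof -
  have "support (inj_matrix p) t \<subseteq> {}" using assms(3) unfolding support_def by auto
  then have "entry (mat_mult (inj_matrix p) a) t s = (\<Oplus>q\<in>{}. entry (inj_matrix p) t q \<otimes> entry a q s)"
    by (intro entry_mult) (use assms inj_matrix_in_matrices in auto)
  then show ?thesis by simp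
qed

lemma inj_matrix_mult_inj_matrix:
  assumes "partial_injection p" "partial_injection q"
  shows "mat_mult (inj_matrix q) (inj_matrix p) = inj_matrix (q \<circ>\<^sub>m p)"
proof (rule matrix_eqI)
  have "partial_injection (q \<circ>\<^sub>m p)"
    using assms unfolding partial_injection_def map_comp_Some_iff by blast
  then show "inj_matrix (q \<circ>\<^sub>m p) \<in> matrices" by (rule inj_matrix_in_matrices)
  show "mat_mult (inj_matrix q) (inj_matrix p) \<in> matrices" using assms by (intro mult_in_matrices inj_matrix_in_matrices)
  fix t s
  show "entry (mat_mult (inj_matrix q) (inj_matrix p)) t s = entry (inj_matrix (q \<circ>\<^sub>m p)) t s"
    using entry_mult_inj_matrix[OF inj_matrix_in_matrices[OF assms(2)] assms(1), of t s]
    by (auto simp: map_comp_def split: option.splits)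
qed

lemma identity_is_partial_injection: "partial_injection (\<lambda>s. if s \<in> B then Some s else None)"
  unfolding partial_injection_def by auto

lemma one_eq_inj_matrix:
  "of_entries \<zero> (\<lambda>t s. if t = s \<and> t \<in> B then \<one> else \<zero>) = inj_matrix (\<lambda>s. if s \<in> B then Some s else None)"
  by (rule matrix_eqI)
     (use one_in_matrices inj_matrix_in_matrices[OF identity_is_partial_injection] in auto)

lemma mult_one:
  assumes "a \<in> matrices"
  shows "mat_mult a (of_entries \<zero> (\<lambda>t s. if t = s \<and> t \<in> B then \<one> else \<zero>)) = a"
proof (rule matrix_eqI)
  fix t s
  show "entry (mat_mult a (of_entries \<zero> (\<lambda>t s. if t = s \<and> t \<in> B then \<one> else \<zero>))) t s = entry a t s"
    unfolding one_eq_inj_matrix entry_mult_inj_matrix[OF assms identity_is_partial_injection]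
    using entry_in_B[OF assms, of t s] by (cases "entry a t s = \<zero>") auto
qed (use assms mult_in_matrices one_in_matrices in auto)

lemma mult_distrib_right:
  assumes abc: "a \<in> matrices" "b \<in> matrices" "c \<in> matrices"
  shows "mat_mult (\<lambda>l. a l \<oplus> b l) c = (\<lambda>l. mat_mult a c l \<oplus> mat_mult b c l)"
proof (rule matrix_eqI)
  fix t s
  let ?R = "support a t \<union> support b t"
  have ab: "(\<lambda>l. a l \<oplus> b l) \<in> matrices" by (rule add_in_matrices[OF abc(1,2)])
  have "support (\<lambda>l. a l \<oplus> b l) t \<subseteq> ?R" unfolding support_def by auto
  then have "entry (mat_mult (\<lambda>l. a l \<oplus> b l) c) t s
      = (\<Oplus>r\<in>?R. entry (\<lambda>l. a l \<oplus> b l) t r \<otimes> entry c r s)"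
    by (intro entry_mult) (use abc ab in auto)
  also have "\<dots> = (\<Oplus>r\<in>?R. entry a t r \<otimes> entry c r s \<oplus> entry b t r \<otimes> entry c r s)"
    by (rule finsum_cong') (use abc in \<open>auto simp: l_distr\<close>)
  also have "\<dots> = (\<Oplus>r\<in>?R. entry a t r \<otimes> entry c r s) \<oplus> (\<Oplus>r\<in>?R. entry b t r \<otimes> entry c r s)"
    by (rule finsum_addf) (use abc in auto)
  also have "(\<Oplus>r\<in>?R. entry a t r \<otimes> entry c r s) = entry (mat_mult a c) t s"
    by (rule entry_mult[symmetric]) (use abc in auto)
  also have "(\<Oplus>r\<in>?R. entry b t r \<otimes> entry c r s) = entry (mat_mult b c) t s"
    by (rule entry_mult[symmetric]) (use abc in auto)
  finally show "entry (mat_mult (\<lambda>l. a l \<oplus> b l) c) t s = entry (\<lambda>l. mat_mult a c l \<oplus> mat_mult b c l) t s"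
    by simp
qed (use abc mult_in_matrices add_in_matrices in auto)

lemma mult_distrib_left:
  assumes abc: "a \<in> matrices" "b \<in> matrices" "c \<in> matrices"
  shows "mat_mult c (\<lambda>l. a l \<oplus> b l) = (\<lambda>l. mat_mult c a l \<oplus> mat_mult c b l)"
proof (rule matrix_eqI)
  fix t s
  let ?R = "support c t"
  have ab: "(\<lambda>l. a l \<oplus> b l) \<in> matrices" by (rule add_in_matrices[OF abc(1,2)])
  have "entry (mat_mult c (\<lambda>l. a l \<oplus> b l)) t s
      = (\<Oplus>r\<in>?R. entry c t r \<otimes> entry (\<lambda>l. a l \<oplus> b l) r s)"
    by (rule entry_mult) (use abc ab in auto)
  also have "\<dots> = (\<Oplus>r\<in>?R. entry c t r \<otimes> entry a r s \<oplus> entry c t r \<otimes> entry b r s)"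
    by (rule finsum_cong') (use abc in \<open>auto simp: r_distr\<close>)
  also have "\<dots> = (\<Oplus>r\<in>?R. entry c t r \<otimes> entry a r s) \<oplus> (\<Oplus>r\<in>?R. entry c t r \<otimes> entry b r s)"
    by (rule finsum_addf) (use abc in auto)
  also have "(\<Oplus>r\<in>?R. entry c t r \<otimes> entry a r s) = entry (mat_mult c a) t s"
    by (rule entry_mult[symmetric]) (use abc in auto)
  also have "(\<Oplus>r\<in>?R. entry c t r \<otimes> entry b r s) = entry (mat_mult c b) t s"
    by (rule entry_mult[symmetric]) (use abc in auto)
  finally show "entry (mat_mult c (\<lambda>l. a l \<oplus> b l)) t s = entry (\<lambda>l. mat_mult c a l \<oplus> mat_mult c b l) t s"
    by simp
qed (use abc mult_in_matrices add_in_matrices in auto)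

lemma smult_mult:
  assumes "k \<in> carrier F" "a \<in> matrices" "b \<in> matrices"
  shows "mat_mult (\<lambda>l. k \<otimes> a l) b = (\<lambda>l. k \<otimes> mat_mult a b l)"
    and "mat_mult a (\<lambda>l. k \<otimes> b l) = (\<lambda>l. k \<otimes> mat_mult a b l)"
proof -
  note abm = mult_in_matrices[OF assms(2,3)]
  have ab: "k \<otimes> entry (mat_mult a b) t s = (\<Oplus>r\<in>support a t. k \<otimes> (entry a t r \<otimes> entry b r s))" for t s
  proof -
    have "entry (mat_mult a b) t s = (\<Oplus>r\<in>support a t. entry a t r \<otimes> entry b r s)"
      by (rule entry_mult) (use assms in auto)
    then show ?thesis using assms by (simp add: finsum_rdistr Pi_def)
  qed
  show "mat_mult (\<lambda>l. k \<otimes> a l) b = (\<lambda>l. k \<otimes> mat_mult a b l)"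
  proof (rule matrix_eqI)
    fix t s
    have "support (\<lambda>l. k \<otimes> a l) t \<subseteq> support a t" unfolding support_def using assms by auto
    then have "entry (mat_mult (\<lambda>l. k \<otimes> a l) b) t s
        = (\<Oplus>r\<in>support a t. entry (\<lambda>l. k \<otimes> a l) t r \<otimes> entry b r s)"
      by (intro entry_mult) (use assms smult_in_matrices in auto)
    also have "\<dots> = (\<Oplus>r\<in>support a t. k \<otimes> (entry a t r \<otimes> entry b r s))"
      by (rule finsum_cong') (use assms in \<open>auto simp: m_assoc\<close>)
    finally show "entry (mat_mult (\<lambda>l. k \<otimes> a l) b) t s = entry (\<lambda>l. k \<otimes> mat_mult a b l) t s"
      using ab by simp
  qed (use assms abm mult_in_matrices smult_in_matrices in auto)
  show "mat_mult a (\<lambda>l. k \<otimes> b l) = (\<lambda>l. k \<otimes> mat_mult a b l)"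
  proof (rule matrix_eqI)
    fix t s
    have "entry (mat_mult a (\<lambda>l. k \<otimes> b l)) t s
        = (\<Oplus>r\<in>support a t. entry a t r \<otimes> entry (\<lambda>l. k \<otimes> b l) r s)"
      by (rule entry_mult) (use assms smult_in_matrices in auto)
    also have "\<dots> = (\<Oplus>r\<in>support a t. k \<otimes> (entry a t r \<otimes> entry b r s))"
      by (rule finsum_cong') (use assms in \<open>auto simp: m_lcomm\<close>)
    finally show "entry (mat_mult a (\<lambda>l. k \<otimes> b l)) t s = entry (\<lambda>l. k \<otimes> mat_mult a b l) t s"
      using ab by simp
  qed (use assms abm mult_in_matrices smult_in_matrices in auto)
qed

lemma matrix_ring_abelian_group: "abelian_group matrix_ring"
proof (rule abelian_groupI)
  fix a assume "a \<in> carrier matrix_ring"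
  then have a: "a \<in> matrices" by (simp add: matrix_ring_simps)
  have "(\<lambda>l. \<ominus> \<one> \<otimes> a l) \<in> matrices" using a by (intro smult_in_matrices) auto
  moreover have "\<ominus> \<one> \<otimes> a l \<oplus> a l = \<zero>" for l using closed[OF a, of l] by (simp add: l_minus l_neg)
  ultimately show "\<exists>b\<in>carrier matrix_ring. b \<oplus>\<^bsub>matrix_ring\<^esub> a = \<zero>\<^bsub>matrix_ring\<^esub>"
    unfolding matrix_ring_simps by (intro bexI[of _ "\<lambda>l. \<ominus> \<one> \<otimes> a l"]) auto
qed (auto simp: matrix_ring_simps add_in_matrices zero_in_matrices closed a_assoc a_comm a_lcomm)

lemma matrix_ring_assoc_algebra: "assoc_algebra F matrix_ring"
proof -
  have "module F matrix_ring"
    by (rule moduleI)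
       (use matrix_ring_abelian_group is_cring in
         \<open>auto simp: matrix_ring_simps smult_in_matrices closed l_distr r_distr m_assoc\<close>)
  then have "vectorspace F matrix_ring" unfolding vectorspace_def using field_axioms by blast
  moreover have "ring matrix_ring"
  proof (rule ringI)
    show "monoid matrix_ring"
      by (rule monoidI)
         (auto simp: matrix_ring_simps mult_in_matrices one_in_matrices mult_assoc one_mult mult_one)
  qed (auto simp: matrix_ring_abelian_group matrix_ring_simps mult_distrib_left mult_distrib_right)
  moreover have "assoc_algebra_axioms F matrix_ring"
    by unfold_locales (auto simp: matrix_ring_simps smult_mult)
  ultimately show ?thesis unfolding assoc_algebra_def by blast
qed

end

section \<open>The operator algebra of the graph\<close>

locale graph_algebra = returning_graph f U C N + field F
  for f U C N and F :: "('f, 'e) ring_scheme" (structure)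
begin

sublocale matrix_algebra F vertices by unfold_locales

sublocale M: assoc_algebra F matrix_ring by (rule matrix_ring_assoc_algebra)

lemma act_partial_injection: "partial_injection (act \<alpha>)"
  unfolding partial_injection_def using act_vertices act_inj by blast

lemma act_matrix: "inj_matrix (act \<alpha>) \<in> matrices"
  by (rule inj_matrix_in_matrices[OF act_partial_injection])

lemma act_matrix_mult: "mat_mult (inj_matrix (act \<beta>)) (inj_matrix (act \<alpha>)) = inj_matrix (act (\<beta> @ \<alpha>))"
  unfolding act_append by (rule inj_matrix_mult_inj_matrix[OF act_partial_injection act_partial_injection])

definition word_matrices :: "nat \<Rightarrow> (nat list \<Rightarrow> 'f) set" where
  "word_matrices n = {inj_matrix (act \<alpha>) |\<alpha>. length \<alpha> \<le> n}"

definition op_algebra :: "('f, nat list \<Rightarrow> 'f) module" where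
  "op_algebra = matrix_ring\<lparr>carrier := M.span (\<Union>n. word_matrices n)\<rparr>"

lemma word_matrices_closed: "(\<Union>n. word_matrices n) \<subseteq> carrier matrix_ring"
  unfolding word_matrices_def matrix_ring_simps using act_matrix by blast

lemma act_matrix_in_words: "inj_matrix (act \<alpha>) \<in> (\<Union>n. word_matrices n)"
  unfolding word_matrices_def by auto

lemma one_matrix_ring: "\<one>\<^bsub>matrix_ring\<^esub> = inj_matrix (act [])"
proof -
  have "act [] = (\<lambda>s. if s \<in> vertices then Some s else None)" by (rule ext) simp
  then show ?thesis unfolding matrix_ring_simps one_eq_inj_matrix by simp
qed

lemma words_subalgebra: "unital_subalgebra F (M.span (\<Union>n. word_matrices n)) matrix_ring"
  unfolding unital_subalgebra_def
proof (intro conjI ballI)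
  let ?W = "\<Union>n. word_matrices n"
  show "VectorSpace.subspace F (M.span ?W) matrix_ring"
    by (rule M.span_is_subspace[OF word_matrices_closed])
  show "\<one>\<^bsub>matrix_ring\<^esub> \<in> M.span ?W"
    unfolding one_matrix_ring using M.in_own_span[OF word_matrices_closed] act_matrix_in_words by blast
  fix x y assume xy: "x \<in> M.span ?W" "y \<in> M.span ?W"
  show "x \<otimes>\<^bsub>matrix_ring\<^esub> y \<in> M.span ?W"
  proof (rule M.span_mult_closed[OF word_matrices_closed word_matrices_closed word_matrices_closed _ xy])
    fix x y assume "x \<in> ?W" "y \<in> ?W"
    then obtain \<alpha> \<beta> where "x = inj_matrix (act \<alpha>)" "y = inj_matrix (act \<beta>)" unfolding word_matrices_def by blast
    then have "x \<otimes>\<^bsub>matrix_ring\<^esub> y = inj_matrix (act (\<alpha> @ \<beta>))" unfolding matrix_ring_simps using act_matrix_mult by simp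
    then show "x \<otimes>\<^bsub>matrix_ring\<^esub> y \<in> M.span ?W"
      using M.in_own_span[OF word_matrices_closed] act_matrix_in_words by auto
  qed
qed

lemma op_algebra_assoc_algebra: "assoc_algebra F op_algebra"
  unfolding op_algebra_def by (rule M.subalgebra_assoc_algebra[OF words_subalgebra])

sublocale A: assoc_algebra F op_algebra by (rule op_algebra_assoc_algebra)

lemma op_algebra_simps: "monoid.mult op_algebra = mat_mult" "\<zero>\<^bsub>op_algebra\<^esub> = (\<lambda>l. \<zero>)" "\<one>\<^bsub>op_algebra\<^esub> = inj_matrix (act [])"
  "add op_algebra = (\<lambda>a b l. a l \<oplus> b l)" "smult op_algebra = (\<lambda>c a l. c \<otimes> a l)"
  using one_matrix_ring by (simp_all add: op_algebra_def matrix_ring_simps)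

lemma span_words_subspace: "VectorSpace.subspace F (M.span (\<Union>n. word_matrices n)) matrix_ring"
  using words_subalgebra unfolding unital_subalgebra_def by blast

lemma op_algebra_matrices: "a \<in> carrier op_algebra \<Longrightarrow> a \<in> matrices"
  using M.span_is_subset2[OF word_matrices_closed] by (auto simp: op_algebra_def matrix_ring_simps)

lemma act_matrix_in_alg: "inj_matrix (act \<alpha>) \<in> carrier op_algebra"
  using M.in_own_span[OF word_matrices_closed] act_matrix_in_words by (auto simp: op_algebra_def)

lemma word_matrices_finite_card:
  "finite (word_matrices n)" "1 \<le> n \<Longrightarrow> card (word_matrices n) \<le> 63 * (n\<^sup>2 * f (4 * n))"
proof -
  have sub: "word_matrices m \<subseteq> inj_matrix ` transformations n" if "m \<le> n" for m n
  proof
    fix a assume "a \<in> word_matrices m"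
    then obtain \<alpha> where "a = inj_matrix (act \<alpha>)" "length \<alpha> \<le> m" unfolding word_matrices_def by blast
    then show "a \<in> inj_matrix ` transformations n"
      using act_in_transformations[of \<alpha>] transformations_mono[of "length \<alpha>" n] that by auto
  qed
  have "finite (inj_matrix ` transformations (Suc n))" using transformations_card[of "Suc n"] by simp
  then show "finite (word_matrices n)" using sub[of n "Suc n"] finite_subset by auto
  assume n: "1 \<le> n"
  have "card (word_matrices n) \<le> card (inj_matrix ` transformations n)"
    by (rule card_mono[OF _ sub]) (use transformations_card[OF n] in auto)
  also have "\<dots> \<le> card (transformations n)" by (rule card_image_le) (use transformations_card[OF n] in auto)
  also have "\<dots> \<le> 63 * (n\<^sup>2 * f (4 * n))" using transformations_card[OF n] by blast
  finally show "card (word_matrices n) \<le> 63 * (n\<^sup>2 * f (4 * n))" .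
qed

sublocale A: word_filtration F op_algebra word_matrices
proof
  show "finite (word_matrices n)" for n by (rule word_matrices_finite_card)
  show "word_matrices n \<subseteq> carrier op_algebra" for n
    unfolding word_matrices_def using act_matrix_in_alg by blast
  show "word_matrices m \<subseteq> word_matrices n" if "m \<le> n" for m n
    unfolding word_matrices_def using that by auto
  show "\<one>\<^bsub>op_algebra\<^esub> \<in> word_matrices 0" unfolding word_matrices_def op_algebra_simps by auto
  show "word_matrices 0 \<subseteq> {\<one>\<^bsub>op_algebra\<^esub>}" unfolding word_matrices_def op_algebra_simps by auto
  show "x \<otimes>\<^bsub>op_algebra\<^esub> y \<in> word_matrices (m + n)" if xy: "x \<in> word_matrices m" "y \<in> word_matrices n" for x y m n
  proof -
    obtain \<alpha> \<beta> where "x = inj_matrix (act \<alpha>)" "y = inj_matrix (act \<beta>)" "length \<alpha> \<le> m" "length \<beta> \<le> n"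
      using xy unfolding word_matrices_def by blast
    then show ?thesis unfolding op_algebra_simps word_matrices_def
      using act_matrix_mult by (auto intro!: exI[of _ "\<alpha> @ \<beta>"])
  qed
  show "word_matrices (Suc n) \<subseteq> word_matrices n
      \<union> {g \<otimes>\<^bsub>op_algebra\<^esub> w |g w. g \<in> word_matrices 1 \<and> w \<in> word_matrices n}" for n
  proof
    fix a assume "a \<in> word_matrices (Suc n)"
    then obtain \<alpha> where \<alpha>: "a = inj_matrix (act \<alpha>)" "length \<alpha> \<le> Suc n" unfolding word_matrices_def by blast
    show "a \<in> word_matrices n \<union> {g \<otimes>\<^bsub>op_algebra\<^esub> w |g w. g \<in> word_matrices 1 \<and> w \<in> word_matrices n}"
    proof (cases \<alpha>)
      case Nil
      then show ?thesis using \<alpha> unfolding word_matrices_def by auto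
    next
      case (Cons g \<beta>)
      then have "a = inj_matrix (act [g]) \<otimes>\<^bsub>op_algebra\<^esub> inj_matrix (act \<beta>)"
        unfolding op_algebra_simps act_matrix_mult using \<alpha> by simp
      moreover have "inj_matrix (act [g]) \<in> word_matrices 1" "inj_matrix (act \<beta>) \<in> word_matrices n"
        using \<alpha> Cons unfolding word_matrices_def by auto
      ultimately show ?thesis by blast
    qed
  qed
  have "A.span (\<Union>n. word_matrices n) = M.span (\<Union>n. word_matrices n)"
    unfolding op_algebra_def
    by (rule M.span_li_not_depend(1)) (use M.in_own_span[OF word_matrices_closed] span_words_subspace in auto)
  then show "carrier op_algebra \<subseteq> A.span (\<Union>n. word_matrices n)" by (simp add: op_algebra_def)
qed

text \<open>Let \<open>g\<close> be the rank one operator \<open>Up 1 Down\<close>, with its only entry in row \<open>[1]\<close> and column \<open>[0]\<close>. An element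
\<open>a g\<close> is the column \<open>[1]\<close> of \<open>a\<close>, moved to the column \<open>[0]\<close>. If its entry in row \<open>t\<close> is not zero, a word \<open>\<alpha>\<close>
that leads from \<open>t\<close> to \<open>[0]\<close> moves this entry to row \<open>[0]\<close>, and \<open>g\<close> then annihilates all other rows;
what remains is a multiple of \<open>g\<close>. For faithfulness, an entry of \<open>a\<close> in column \<open>s\<close> is seen in \<open>a \<beta> g\<close> for a
word \<open>\<beta>\<close> that leads from \<open>[1]\<close> to \<open>s\<close>.\<close>
lemma op_algebra_primitive: "primitive_ring op_algebra"
proof -
  let ?e = "[Up 1, Down]"
  define g where "g = inj_matrix (act ?e)"
  have g_alg: "g \<in> carrier op_algebra" unfolding g_def by (rule act_matrix_in_alg)
  have e: "act ?e s = Some t \<longleftrightarrow> s = [0] \<and> t = [1]" for s t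
    unfolding act_point(1) by auto
  have entry_g: "entry g t s = (if s = [0] \<and> t = [1] then \<one> else \<zero>)" for t s
    unfolding g_def entry_inj_matrix e by simp
  have entry_mult_g: "entry (mat_mult a g) t s = (if s = [0] then entry a t [1] else \<zero>)"
    if "a \<in> matrices" for a t s
    using entry_mult_inj_matrix[OF that act_partial_injection[of ?e], of t s]
    unfolding g_def act_point(1) by simp
  have zero: "a = (\<lambda>l. \<zero>)" if "a \<in> matrices" "\<And>t s. entry a t s = \<zero>" for a
    by (rule matrix_eqI) (use that zero_in_matrices in auto)
  show ?thesis
  proof (rule A.alg.primitive_ringI[OF g_alg])
    show "g \<noteq> \<zero>\<^bsub>op_algebra\<^esub>"
    proof
      assume "g = \<zero>\<^bsub>op_algebra\<^esub>"
      then have "entry g [1] [0] = \<zero>" unfolding op_algebra_simps by simp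
      then show False unfolding entry_g by simp
    qed
  next
    fix a assume a: "a \<in> carrier op_algebra" "a \<otimes>\<^bsub>op_algebra\<^esub> g \<noteq> \<zero>\<^bsub>op_algebra\<^esub>"
    let ?m = "mat_mult a g"
    have am: "a \<in> matrices" by (rule op_algebra_matrices[OF a(1)])
    have mm: "?m \<in> matrices" using am op_algebra_matrices[OF g_alg] by (rule mult_in_matrices)
    obtain t s where "entry ?m t s \<noteq> \<zero>" using zero[OF mm] a(2) unfolding op_algebra_simps by blast
    then have c: "entry a t [1] \<noteq> \<zero>" unfolding entry_mult_g[OF am] by (auto split: if_splits)
    then have t: "t \<in> vertices" using entry_in_B[OF am] by blast
    obtain \<alpha> where \<alpha>: "act \<alpha> t = Some [0]" using act_transitive[OF t act_point(3)] by blast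
    let ?p = "act (?e @ \<alpha>)"
    have p: "?p t = Some [1]" using \<alpha> e unfolding act_append map_comp_def by simp
    have p_range: "t' = [1]" if "?p r = Some t'" for r t'
      using that e unfolding act_append map_comp_Some_iff by blast
    let ?i = "inv entry a t [1]"
    have i: "?i \<in> carrier F" "?i \<otimes> entry a t [1] = \<one>"
      using c entry_closed[OF am, of t "[1]"] by (auto simp: field_Units)
    let ?b = "\<lambda>l. ?i \<otimes> inj_matrix ?p l"
    have b: "?b \<in> carrier op_algebra"
      using A.smult_closed[OF i(1) act_matrix_in_alg[of "?e @ \<alpha>"]] unfolding op_algebra_simps .
    have "mat_mult ?b ?m = g"
    proof (rule matrix_eqI)
      show "mat_mult ?b ?m \<in> matrices" using op_algebra_matrices[OF b] mm by (rule mult_in_matrices)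
      show "g \<in> matrices" by (rule op_algebra_matrices[OF g_alg])
      fix t' s
      have *: "entry (mat_mult ?b ?m) t' s = ?i \<otimes> entry (mat_mult (inj_matrix ?p) ?m) t' s"
        unfolding smult_mult(1)[OF i(1) act_matrix mm] by simp
      show "entry (mat_mult ?b ?m) t' s = entry g t' s"
      proof (cases "t' = [1]")
        case True
        have "entry (mat_mult (inj_matrix ?p) ?m) t' s = entry ?m t s"
          unfolding True by (rule entry_inj_matrix_mult[OF mm act_partial_injection p])
        then show ?thesis
          unfolding * using i True by (simp add: entry_mult_g[OF am] entry_g)
      next
        case False
        then have "entry (mat_mult (inj_matrix ?p) ?m) t' s = \<zero>"
          using p_range by (intro entry_inj_matrix_mult_zero[OF mm act_partial_injection]) blast
        then show ?thesis unfolding * entry_g using False i by simp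
      qed
    qed
    then show "\<exists>b\<in>carrier op_algebra. b \<otimes>\<^bsub>op_algebra\<^esub> (a \<otimes>\<^bsub>op_algebra\<^esub> g) = g"
      using b unfolding op_algebra_simps by (rule bexI[of _ ?b])
  next
    fix a assume a: "a \<in> carrier op_algebra"
      and ann: "\<And>x. x \<in> carrier op_algebra \<Longrightarrow> a \<otimes>\<^bsub>op_algebra\<^esub> (x \<otimes>\<^bsub>op_algebra\<^esub> g) = \<zero>\<^bsub>op_algebra\<^esub>"
    have am: "a \<in> matrices" by (rule op_algebra_matrices[OF a])
    have "entry a t s = \<zero>" for t s
    proof (rule ccontr)
      assume "entry a t s \<noteq> \<zero>"
      then have "s \<in> vertices" using entry_in_B[OF am] by blast
      then obtain \<beta> where \<beta>: "act \<beta> [1] = Some s" using act_transitive[OF act_point(2)] by blast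
      have s: "act (\<beta> @ ?e) [0] = Some s" unfolding act_append act_point(1) using \<beta> by simp
      have "mat_mult a (inj_matrix (act (\<beta> @ ?e))) = (\<lambda>l. \<zero>)"
        using ann[OF act_matrix_in_alg[of \<beta>]] unfolding op_algebra_simps g_def act_matrix_mult .
      then have "entry (mat_mult a (inj_matrix (act (\<beta> @ ?e)))) t [0] = \<zero>" by simp
      then show False
        unfolding entry_mult_inj_matrix[OF am act_partial_injection] s using \<open>entry a t s \<noteq> \<zero>\<close> by simp
    qed
    then show "a = \<zero>\<^bsub>op_algebra\<^esub>" unfolding op_algebra_simps using zero[OF am] by blast
  qed
qed

text \<open>For a block \<open>u\<close>, the entry in row \<open>u\<close> and column \<open>[]\<close> is \<open>1\<close> for the operator labelled by \<open>u\<close> and \<open>0\<close> for those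
labelled by other blocks.\<close>
lemma block_matrices_independent:
  fixes k
  defines "T \<equiv> (\<lambda>u. inj_matrix (act (map Up u))) ` U k"
  shows "card T = card (U k)" "A.lin_indpt T" "T \<subseteq> word_matrices (2 ^ k)"
proof -
  have from_root: "act (map Up u) [] = Some u" if "u \<in> U k" for u
    using act_up[of u "[]"] that U_in_blocks blocks_subset_tails by auto
  have inj: "u = u'" if "u \<in> U k" "u' \<in> U k" "inj_matrix (act (map Up u)) = inj_matrix (act (map Up u'))" for u u'
  proof -
    have "entry (inj_matrix (act (map Up u))) u [] = entry (inj_matrix (act (map Up u'))) u []" using that by simp
    then have "act (map Up u') [] = Some u"
      using from_root[OF that(1)] by (simp split: if_splits)
    then show ?thesis using from_root[OF that(2)] by simp
  qed
  then show "card T = card (U k)" unfolding T_def by (intro card_image inj_onI) auto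
  show words: "T \<subseteq> word_matrices (2 ^ k)"
    unfolding T_def word_matrices_def using length_U[of _ k] by fastforce
  have Tc: "T \<subseteq> carrier op_algebra" unfolding T_def using act_matrix_in_alg by blast
  have finT: "finite T" unfolding T_def using finite_U by simp
  show "A.lin_indpt T"
    unfolding A.lindep_span[OF Tc finT]
  proof
    assume "\<exists>x\<in>T. x \<in> A.span (T - {x})"
    then obtain u where u: "u \<in> U k" "inj_matrix (act (map Up u)) \<in> A.span (T - {inj_matrix (act (map Up u))})"
      unfolding T_def by blast
    let ?S = "{a \<in> carrier op_algebra. entry a u [] = \<zero>}"
    have "LinearCombinations.submodule F ?S op_algebra"
    proof (rule LinearCombinations.submodule.intro)
      show "module F op_algebra" ..
      show "v \<oplus>\<^bsub>op_algebra\<^esub> w \<in> ?S" if "v \<in> ?S" "w \<in> ?S" for v w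
      proof -
        have "v \<oplus>\<^bsub>op_algebra\<^esub> w \<in> carrier op_algebra" using that by simp
        moreover have "entry (v \<oplus>\<^bsub>op_algebra\<^esub> w) u [] = \<zero>" using that unfolding op_algebra_simps by simp
        ultimately show ?thesis by blast
      qed
      show "\<zero>\<^bsub>op_algebra\<^esub> \<in> ?S" using ring.ring_simprules(2)[OF A.alg.ring_axioms] unfolding op_algebra_simps by simp
      show "c \<odot>\<^bsub>op_algebra\<^esub> v \<in> ?S" if "c \<in> carrier F" "v \<in> ?S" for c v
      proof -
        have "c \<odot>\<^bsub>op_algebra\<^esub> v \<in> carrier op_algebra" using that by simp
        moreover have "entry (c \<odot>\<^bsub>op_algebra\<^esub> v) u [] = \<zero>" using that unfolding op_algebra_simps by simp
        ultimately show ?thesis by blast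
      qed
    qed blast
    moreover have "T - {inj_matrix (act (map Up u))} \<subseteq> ?S"
    proof
      fix x assume x: "x \<in> T - {inj_matrix (act (map Up u))}"
      then obtain u' where "u' \<in> U k" "x = inj_matrix (act (map Up u'))" "u' \<noteq> u" unfolding T_def by blast
      then show "x \<in> ?S" using from_root act_matrix_in_alg by simp
    qed
    ultimately have "inj_matrix (act (map Up u)) \<in> ?S" using A.span_is_subset u(2) by blast
    then show False using from_root[OF u(1)] by simp
  qed
qed

text \<open>Up to the constant \<open>c\<close> that compares \<open>V\<close> with the generators, \<open>2 * n\<close> steps suffice: there is a power of two
between \<open>n\<close> and \<open>2 * n\<close>.\<close>
lemma growth_lower:
  assumes V: "generating_subspace F op_algebra V"
  shows "f \<preceq>\<^sub>g growth F op_algebra V"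
proof -
  obtain c where c: "c \<ge> 1" "\<And>n. word_matrices n \<subseteq> A.powers_upto V (c * n)"
    using A.W_subset_powers_upto[OF V] by blast
  have "f n \<le> growth F op_algebra V (2 * c * n)" if n: "1 \<le> n" for n
  proof -
    obtain k where k: "n \<le> 2 ^ k" "2 ^ k < 2 * n" using exists_power_two_above[OF n] by blast
    let ?T = "(\<lambda>u. inj_matrix (act (map Up u))) ` U k"
    note T = block_matrices_independent[of k]
    have "?T \<subseteq> word_matrices (2 * n)"
      using T(3) A.W_mono[of "2 ^ k" "2 * n"] k by auto
    then have "?T \<subseteq> A.powers_upto V (c * (2 * n))" using c(2) by blast
    then have "card ?T \<le> growth F op_algebra V (c * (2 * n))"
      by (rule A.card_indep_le_growth[OF V _ T(2)])
    moreover have "f n \<le> f (2 ^ k)" using n k by (intro f_mono) auto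
    ultimately show ?thesis using T(1) card_U_ge[of k] by (simp add: mult.left_commute mult.assoc)
  qed
  then show ?thesis unfolding growth_preceq_def using c(1) by (intro exI[of _ "2 * c"]) auto
qed

text \<open>The constant \<open>8 * c\<close> absorbs the numerical factor \<open>63\<close> of the count into the square, and the argument
\<open>4 * c * n\<close> by monotonicity of \<open>f\<close>.\<close>
lemma growth_upper:
  assumes V: "generating_subspace F op_algebra V"
  shows "growth F op_algebra V \<preceq>\<^sub>g (\<lambda>n. n\<^sup>2 * f n)"
proof -
  obtain c where c: "c \<ge> 1" "V \<subseteq> A.span (word_matrices c)"
    using A.generating_subspace_in_span_W[OF V] by blast
  have "growth F op_algebra V n \<le> (8 * c * n)\<^sup>2 * f (8 * c * n)" if n: "1 \<le> n" for n
  proof -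
    have cn: "1 \<le> c * n" using c n by simp
    have "growth F op_algebra V n \<le> card (word_matrices (c * n))" by (rule A.growth_le[OF c(2)])
    also have "\<dots> \<le> 63 * ((c * n)\<^sup>2 * f (4 * (c * n)))" by (rule word_matrices_finite_card(2)[OF cn])
    also have "\<dots> \<le> 64 * ((c * n)\<^sup>2 * f (8 * c * n))"
    proof (rule mult_le_mono[OF _ mult_le_mono2])
      show "f (4 * (c * n)) \<le> f (8 * c * n)" using cn by (intro f_mono) auto
    qed simp
    also have "\<dots> = (8 * c * n)\<^sup>2 * f (8 * c * n)" by (simp add: power_mult_distrib)
    finally show ?thesis .
  qed
  then show ?thesis unfolding growth_preceq_def using c(1) by (intro exI[of _ "8 * c"]) auto
qed

end

theorem proposition1p6:
  fixes F :: "('f, 'e) ring_scheme" and f :: "nat \<Rightarrow> nat"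
  assumes "field F"
    and "\<forall>n\<ge>1. f n \<ge> 1"
    and "increasing_fun f"
    and "submultiplicative_fun f"
  shows "\<exists>A :: ('f, nat list \<Rightarrow> 'f) module.
           finitely_generated_algebra F A \<and> primitive_ring A \<and>
           (\<forall>V. generating_subspace F A V \<longrightarrow>
                f \<preceq>\<^sub>g growth F A V \<and> growth F A V \<preceq>\<^sub>g (\<lambda>n. n\<^sup>2 * f n))"
proof -
  obtain U C where "block_language f U C"
    using block_sequence_exists[OF assms(2-4)] by blast
  then obtain N where "returning_graph f U C N"
    using block_language.return_positions_exist by blast
  then interpret graph_algebra f U C N F
    using assms(1) by (rule graph_algebra.intro)
  show ?thesis
    by (intro exI[of _ op_algebra] conjI allI impI A.finitely_generated op_algebra_primitive growth_lower growth_upper)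
qed

end
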